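(* The theory $\mathsf{UDCO}$ is complete.
   Context: A nonstrict cyclic order $\unlhd(x,y,z)$ is the reflexive closure of a strict cyclic order. A subset $S$ of a cyclic order is order-convex if for all $a,b\in S$, either every $c$ with $\unlhd(a,c,b)$ lies in $S$ or every $c$ with $\unlhd(b,c,a)$ lies in $S$. A metric cyclic order is a complete metric space of diameter $\le 1$ with a cyclic order such that every open ball is order-convex, viewed as a continuous-logic structure in the language $\{d_\unlhd\}$ where $d_\unlhd$ is the distance (max-metric on $M^3$) to the set of triples satisfying $\unlhd$; $\mathsf{MCO}$ is the theory whose models are exactly these. $\mathsf{DU}$ is the theory of ultrametric spaces in which every $\{d(a,b): b\in M\}$ is dense in $[0,1]$. $\mathsf{UDCO}$ is $\mathsf{MCO}\cup\mathsf{DU}$ together with, for every $p\in\mathbb{Q}\cap(0,1)$, the axioms $\sup_{u,v}\inf_{(x,y,z) \in \unlhd} \big(d(u,x) + d(v,y) + |d(u,z) - p\,d(u,v)|\big) = 0$ and $\sup_{u,v}\inf_{(x,y,z) \in \unlhd} \big(d(u,x) + d(v,y) + |d(v,z) - p\,d(u,v)|\big) = 0$. A theory is complete if it is the theory of some structure (all its models are elementarily equivalent). *)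

theory Defs
  imports "HOL-Analysis.Analysis"
begin

section \<open>Continuous logic over the language with one ternary predicate\<close>

record 'a cyc_structure =
  pts :: "'a set"
  dst :: "'a \<Rightarrow> 'a \<Rightarrow> real"
  dcyc :: "'a \<Rightarrow> 'a \<Rightarrow> 'a \<Rightarrow> real"

text \<open>As usual in continuous logic, the metric is a logical symbol. A connective applied to
  \<open>n\<close> formulas is an arbitrary continuous function \<open>[0,1]\<^sup>n \<rightarrow> [0,1]\<close>; the cube \<open>[0,1]\<^sup>n\<close> is
  represented by the sequences that lie in \<open>[0,1]\<close> below \<open>n\<close> and vanish from \<open>n\<close> on, with the
  product topology.\<close>

datatype fm =
    FDist nat nat
  | FCyc nat nat nat
  | FConn "(nat \<Rightarrow> real) \<Rightarrow> real" "fm list"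
  | FSup nat fm
  | FInf nat fm

definition cube :: "nat \<Rightarrow> (nat \<Rightarrow> real) set" where
  "cube n = {x. (\<forall>i<n. x i \<in> {0..1}) \<and> (\<forall>i\<ge>n. x i = 0)}"

definition connective :: "nat \<Rightarrow> ((nat \<Rightarrow> real) \<Rightarrow> real) \<Rightarrow> bool" where
  "connective n u \<longleftrightarrow> continuous_on (cube n) u \<and> u ` cube n \<subseteq> {0..1}"

fun wf_fm :: "fm \<Rightarrow> bool" where
  "wf_fm (FDist i j) \<longleftrightarrow> True"
| "wf_fm (FCyc i j k) \<longleftrightarrow> True"
| "wf_fm (FConn u \<phi>s) \<longleftrightarrow> connective (length \<phi>s) u \<and> (\<forall>\<phi>\<in>set \<phi>s. wf_fm \<phi>)"
| "wf_fm (FSup i \<phi>) \<longleftrightarrow> wf_fm \<phi>"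
| "wf_fm (FInf i \<phi>) \<longleftrightarrow> wf_fm \<phi>"

fun free_vars :: "fm \<Rightarrow> nat set" where
  "free_vars (FDist i j) = {i, j}"
| "free_vars (FCyc i j k) = {i, j, k}"
| "free_vars (FConn u \<phi>s) = (\<Union>\<phi>\<in>set \<phi>s. free_vars \<phi>)"
| "free_vars (FSup i \<phi>) = free_vars \<phi> - {i}"
| "free_vars (FInf i \<phi>) = free_vars \<phi> - {i}"

definition sentence :: "fm \<Rightarrow> bool" where
  "sentence \<phi> \<longleftrightarrow> wf_fm \<phi> \<and> free_vars \<phi> = {}"

fun val :: "'a cyc_structure \<Rightarrow> fm \<Rightarrow> (nat \<Rightarrow> 'a) \<Rightarrow> real" where
  "val M (FDist i j) e = dst M (e i) (e j)"
| "val M (FCyc i j k) e = dcyc M (e i) (e j) (e k)"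
| "val M (FConn u \<phi>s) e =
     u (\<lambda>i. if i < length \<phi>s then map (\<lambda>\<phi>. val M \<phi> e) \<phi>s ! i else 0)"
| "val M (FSup i \<phi>) e = (SUP a\<in>pts M. val M \<phi> (e(i := a)))"
| "val M (FInf i \<phi>) e = (INF a\<in>pts M. val M \<phi> (e(i := a)))"

definition elem_equiv :: "'a cyc_structure \<Rightarrow> 'b cyc_structure \<Rightarrow> bool" where
  "elem_equiv M N \<longleftrightarrow>
     (\<forall>\<phi> e e'. sentence \<phi> \<longrightarrow> range e \<subseteq> pts M \<longrightarrow> range e' \<subseteq> pts N \<longrightarrow> val M \<phi> e = val N \<phi> e')"


section \<open>Metric cyclic orders\<close>

definition strict_cyclic_order :: "'a set \<Rightarrow> ('a \<Rightarrow> 'a \<Rightarrow> 'a \<Rightarrow> bool) \<Rightarrow> bool" where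
  "strict_cyclic_order A R \<longleftrightarrow>
     (\<forall>a\<in>A. \<forall>b\<in>A. \<forall>c\<in>A. R a b c \<longrightarrow> R b c a) \<and>
     (\<forall>a\<in>A. \<forall>b\<in>A. \<forall>c\<in>A. R a b c \<longrightarrow> \<not> R c b a) \<and>
     (\<forall>a\<in>A. \<forall>b\<in>A. \<forall>c\<in>A. \<forall>d\<in>A. R a b c \<longrightarrow> R a c d \<longrightarrow> R a b d) \<and>
     (\<forall>a\<in>A. \<forall>b\<in>A. \<forall>c\<in>A. a \<noteq> b \<longrightarrow> b \<noteq> c \<longrightarrow> c \<noteq> a \<longrightarrow> R a b c \<or> R c b a)"

definition nonstrict :: "('a \<Rightarrow> 'a \<Rightarrow> 'a \<Rightarrow> bool) \<Rightarrow> 'a \<Rightarrow> 'a \<Rightarrow> 'a \<Rightarrow> bool" where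
  "nonstrict R x y z \<longleftrightarrow> R x y z \<or> x = y \<or> y = z \<or> z = x"

definition nonstrict_set :: "'a set \<Rightarrow> ('a \<Rightarrow> 'a \<Rightarrow> 'a \<Rightarrow> bool) \<Rightarrow> ('a \<times> 'a \<times> 'a) set" where
  "nonstrict_set A R = {(x, y, z) \<in> A \<times> A \<times> A. nonstrict R x y z}"

text \<open>The two arcs between \<open>a\<close> and \<open>b\<close> only make sense for \<open>a \<noteq> b\<close>: the relation
  \<open>nonstrict R a c a\<close> holds for every \<open>c\<close>, so without this restriction no proper nonempty
  subset would be order-convex.\<close>

definition order_convex :: "'a set \<Rightarrow> ('a \<Rightarrow> 'a \<Rightarrow> 'a \<Rightarrow> bool) \<Rightarrow> 'a set \<Rightarrow> bool" where
  "order_convex A R S \<longleftrightarrow>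
     (\<forall>a\<in>S. \<forall>b\<in>S. a \<noteq> b \<longrightarrow>
        (\<forall>c\<in>A. nonstrict R a c b \<longrightarrow> c \<in> S) \<or> (\<forall>c\<in>A. nonstrict R b c a \<longrightarrow> c \<in> S))"

definition metric_cyclic_order ::
    "'a cyc_structure \<Rightarrow> ('a \<Rightarrow> 'a \<Rightarrow> 'a \<Rightarrow> bool) \<Rightarrow> bool" where
  "metric_cyclic_order M R \<longleftrightarrow>
     pts M \<noteq> {} \<and>
     Metric_space (pts M) (dst M) \<and>
     Metric_space.mcomplete (pts M) (dst M) \<and>
     (\<forall>x\<in>pts M. \<forall>y\<in>pts M. dst M x y \<le> 1) \<and>
     strict_cyclic_order (pts M) R \<and>
     (\<forall>x\<in>pts M. \<forall>r. order_convex (pts M) R (Metric_space.mball (pts M) (dst M) x r)) \<and>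
     (\<forall>x\<in>pts M. \<forall>y\<in>pts M. \<forall>z\<in>pts M.
        dcyc M x y z =
          (INF (x', y', z')\<in>nonstrict_set (pts M) R.
             max (dst M x x') (max (dst M y y') (dst M z z'))))"

definition DU_model :: "'a cyc_structure \<Rightarrow> bool" where
  "DU_model M \<longleftrightarrow>
     (\<forall>x\<in>pts M. \<forall>y\<in>pts M. \<forall>z\<in>pts M. dst M x z \<le> max (dst M x y) (dst M y z)) \<and>
     (\<forall>a\<in>pts M. {0..1} \<subseteq> closure (dst M a ` pts M))"

definition UDCO_axioms ::
    "'a cyc_structure \<Rightarrow> ('a \<Rightarrow> 'a \<Rightarrow> 'a \<Rightarrow> bool) \<Rightarrow> real \<Rightarrow> bool" where
  "UDCO_axioms M R p \<longleftrightarrow>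
     (SUP (u, v)\<in>pts M \<times> pts M. INF (x, y, z)\<in>nonstrict_set (pts M) R.
        dst M u x + dst M v y + \<bar>dst M u z - p * dst M u v\<bar>) = 0 \<and>
     (SUP (u, v)\<in>pts M \<times> pts M. INF (x, y, z)\<in>nonstrict_set (pts M) R.
        dst M u x + dst M v y + \<bar>dst M v z - p * dst M u v\<bar>) = 0"

text \<open>A theory enters only through its models. The order \<open>R\<close> on \<open>pts M\<close> is determined by
  \<open>dcyc M\<close>, whose zero set is \<open>nonstrict_set (pts M) R\<close>.\<close>

definition UDCO_model :: "'a cyc_structure \<Rightarrow> bool" where
  "UDCO_model M \<longleftrightarrow>
     (\<exists>R. metric_cyclic_order M R \<and> DU_model M \<and> (\<forall>p\<in>\<rat> \<inter> {0<..<1}. UDCO_axioms M R p))"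

end

theory Submission
  imports Defs
begin

text \<open>Elementary equivalence is a back-and-forth argument with finite partial maps between two
  models that preserve the atomic predicates up to \<open>\<delta>\<close>. Such a map is first thinned out to
  points that are far apart compared to \<open>\<delta>\<close>; since balls are order-convex, it then preserves
  the cyclic order exactly. A new point \<open>c\<close> lies in a gap between two neighbours, one of which is
  a nearest point to \<open>c\<close>, and the density axioms provide a point next to the image of this
  neighbour, in the corresponding gap and at almost the same distance. The loss in \<open>\<delta>\<close> is a constant
  factor, so an induction on formulas shows that values of formulas are approximately preserved.\<close>

section \<open>Ultrametric spaces with a cyclic order and order-convex balls\<close>

text \<open>The obstacle is that an error hides orientation: the cyclic distance of a wrongly
  oriented triple is the least of its pairwise distances, so values known up to
  \<open>\<delta>\<close> do not reveal how almost coincident points are arranged. Hence the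
  thinning: once all distances exceed \<open>4 * \<delta>\<close>, cyclic distances tell the two
  orientations apart. One neighbour suffices for the distances because the space is ultrametric: the
  distance from \<open>c\<close> to any point of the tuple is the maximum of the distance to the
  nearest point and a distance inside the tuple. Neither saturation nor a limit is involved, since a
  formula has finitely many quantifiers and the initial error can be chosen small enough for all of
  them. Completeness also asks for a model, which is built from lexicographically ordered
  functions.\<close>

locale ultra_cyclic =
  fixes X :: "'a set" and d :: "'a \<Rightarrow> 'a \<Rightarrow> real" and R :: "'a \<Rightarrow> 'a \<Rightarrow> 'a \<Rightarrow> bool"
  assumes nonneg: "0 \<le> d x y"
    and commute: "d x y = d y x"
    and zero: "x \<in> X \<Longrightarrow> y \<in> X \<Longrightarrow> d x y = 0 \<longleftrightarrow> x = y"
    and ultra: "x \<in> X \<Longrightarrow> y \<in> X \<Longrightarrow> z \<in> X \<Longrightarrow> d x z \<le> max (d x y) (d y z)"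
    and le_one: "x \<in> X \<Longrightarrow> y \<in> X \<Longrightarrow> d x y \<le> 1"
    and rot: "x \<in> X \<Longrightarrow> y \<in> X \<Longrightarrow> z \<in> X \<Longrightarrow> R x y z \<Longrightarrow> R y z x"
    and asym: "x \<in> X \<Longrightarrow> y \<in> X \<Longrightarrow> z \<in> X \<Longrightarrow> R x y z \<Longrightarrow> \<not> R z y x"
    and trans: "x \<in> X \<Longrightarrow> y \<in> X \<Longrightarrow> z \<in> X \<Longrightarrow> w \<in> X \<Longrightarrow> R x y z \<Longrightarrow> R x z w \<Longrightarrow> R x y w"
    and total: "x \<in> X \<Longrightarrow> y \<in> X \<Longrightarrow> z \<in> X \<Longrightarrow> x \<noteq> y \<Longrightarrow> y \<noteq> z \<Longrightarrow> z \<noteq> x \<Longrightarrow> R x y z \<or> R z y x"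
    and ball_convex: "x \<in> X \<Longrightarrow> order_convex X R {y \<in> X. d x y < r}"
begin

lemma distinct:
  assumes "x \<in> X" "y \<in> X" "z \<in> X" "R x y z"
  shows "x \<noteq> y" "y \<noteq> z" "z \<noteq> x"
  using assms rot[of x y z] rot[of y z x] asym[of x y z] asym[of y z x] asym[of z x y] by auto

lemma rot':
  assumes "x \<in> X" "y \<in> X" "z \<in> X" "R x y z"
  shows "R z x y"
  using rot[OF _ _ _ rot[OF _ _ _ assms(4)]] assms by simp

lemma isosceles:
  assumes "x \<in> X" "y \<in> X" "z \<in> X" "d x y \<noteq> d y z"
  shows "d x z = max (d x y) (d y z)"
  using ultra[of x y z] ultra[of x z y] ultra[of y x z] assms commute[of x y] commute[of y z] by linarith

lemma nearest_dist:
  assumes "c \<in> X" "p \<in> X" "x \<in> X" "d c p \<le> d c x"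
  shows "d c x = max (d c p) (d p x)"
  using ultra[of c p x] ultra[of p c x] assms commute[of c p] by linarith

text \<open>This is the form in which order-convexity is used: \<open>u\<close> and \<open>v\<close>
  lie on the two different arcs between \<open>a\<close> and \<open>b\<close>, and a ball containing
  \<open>a\<close> and \<open>b\<close> has to contain one of these arcs.\<close>

lemma ball_not_separated:
  assumes X: "x \<in> X" "a \<in> X" "b \<in> X" "u \<in> X" "v \<in> X"
    and R: "R a u b" "R b v a"
    and d: "d x a < r" "d x b < r" "r \<le> d x u" "r \<le> d x v"
  shows False
proof -
  have "a \<noteq> b" using distinct(3)[OF _ _ _ R(1)] X by auto
  with ball_convex[OF X(1), of r] X d R show False
    unfolding order_convex_def nonstrict_def by fastforce
qed

text \<open>If the orientation changed, \<open>y\<close> and \<open>z\<close> would lie on different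
  arcs between \<open>x\<close> and \<open>x'\<close>, although the ball around \<open>x\<close> of
  radius \<open>min (d x y) (d x z)\<close> contains \<open>x\<close> and \<open>x'\<close> but
  neither \<open>y\<close> nor \<open>z\<close>.\<close>

lemma move_one:
  assumes X: "x \<in> X" "y \<in> X" "z \<in> X" "x' \<in> X"
    and R: "R x y z" and d: "d x x' < d x y" "d x x' < d x z"
  shows "R x' y z"
proof (rule ccontr)
  assume "\<not> R x' y z"
  moreover have "x' \<noteq> y" "x' \<noteq> z" "y \<noteq> z" using d distinct[OF X(1-3) R] by auto
  ultimately have R': "R z y x'" using total[of x' y z] X by auto
  have "R y x' x" using trans[of y x' z x] rot R R' X by blast
  moreover have "R z x x'" using trans[of z x y x'] rot R R' X by blast
  ultimately have "R x y x'" "R x' z x" using rot X by blast+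
  moreover have "d x x < min (d x y) (d x z)"
    using d nonneg[of x x'] zero[of x x] X by auto
  ultimately show False
    using ball_not_separated[of x x x' y z "min (d x y) (d x z)"] d X by auto
qed

text \<open>The points are moved one at a time. After each move the isosceles property leaves the
  distances to the other two points unchanged, so the bound \<open>m\<close> is still available for
  the next move.\<close>

lemma move_all:
  assumes X: "x \<in> X" "y \<in> X" "z \<in> X" "x' \<in> X" "y' \<in> X" "z' \<in> X"
    and R: "R x y z" and d: "d x x' < m" "d y y' < m" "d z z' < m"
    and m: "m \<le> d x y" "m \<le> d y z" "m \<le> d x z"
  shows "R x' y' z'"
proof -
  have 1: "R x' y z" using move_one[of x y z x'] X R d m by auto
  have e: "d x' y = d x y" "d x' z = d x z"
    using isosceles[of x' x y] isosceles[of x' x z] commute[of x x'] d m X by auto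
  have 2: "R y' z x'" using move_one[of y z x' y'] rot[OF _ _ _ 1] X d m e commute[of y x'] by auto
  have "d y' z = d y z" "d x' y' = d x y"
    using isosceles[of y' y z] isosceles[of x' y y'] commute[of y y'] e d m X by auto
  then have "R z' x' y'" using move_one[of z x' y' z'] rot[OF _ _ _ 2] X d m e
    commute[of z x'] commute[of z y'] by auto
  then show ?thesis using rot X by blast
qed

section \<open>The distance to the cyclic order in closed form\<close>

definition dc :: "'a \<Rightarrow> 'a \<Rightarrow> 'a \<Rightarrow> real" where
  "dc x y z = (if nonstrict R x y z then 0 else min (d x y) (min (d y z) (d x z)))"

lemma not_nonstrict:
  assumes "x \<in> X" "y \<in> X" "z \<in> X"
  shows "\<not> nonstrict R x y z \<longleftrightarrow> R z y x"
  using assms asym[of x y z] total[of x y z] distinct[of z y x] unfolding nonstrict_def by auto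

text \<open>A wrongly oriented triple is repaired most cheaply by merging two of its points, which
  costs their distance. By \<open>move_all\<close>, movements below the least pairwise distance
  cannot change the orientation.\<close>

lemma dc_eq_INF:
  assumes X: "x \<in> X" "y \<in> X" "z \<in> X"
  shows "(INF (x', y', z')\<in>nonstrict_set X R. max (d x x') (max (d y y') (d z z'))) = dc x y z"
    (is "Inf (?f ` ?S) = _")
proof -
  have S: "(x, x, x) \<in> ?S" using X by (auto simp: nonstrict_set_def nonstrict_def)
  have 0: "0 \<le> ?f p" for p by (cases p) (auto simp: nonneg le_max_iff_disj)
  have bdd: "bdd_below (?f ` ?S)" using 0 by (intro bdd_belowI[of _ 0]) auto
  have up: "Inf (?f ` ?S) \<le> t" if "p \<in> ?S" "?f p = t" for p t
    using cINF_lower[OF bdd that(1)] that(2) by simp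
  have d0: "d w w = 0" if "w \<in> X" for w using zero that by blast
  show ?thesis
  proof (cases "nonstrict R x y z")
    case True
    have "Inf (?f ` ?S) \<le> 0"
      using X True d0 by (intro up[of "(x,y,z)"]) (auto simp: nonstrict_set_def)
    moreover have "0 \<le> Inf (?f ` ?S)" using 0 S by (intro cINF_greatest) auto
    ultimately show ?thesis using True by (simp add: dc_def)
  next
    case False
    let ?m = "min (d x y) (min (d y z) (d x z))"
    have "Inf (?f ` ?S) \<le> d x y"
      using X d0 nonneg[of x y] by (intro up[of "(y,y,z)"]) (auto simp: nonstrict_set_def nonstrict_def)
    moreover have "Inf (?f ` ?S) \<le> d y z"
      using X d0 nonneg[of y z] by (intro up[of "(x,z,z)"]) (auto simp: nonstrict_set_def nonstrict_def)
    moreover have "Inf (?f ` ?S) \<le> d x z"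
      using X d0 nonneg[of x z] by (intro up[of "(z,y,z)"]) (auto simp: nonstrict_set_def nonstrict_def)
    moreover have "?m \<le> Inf (?f ` ?S)"
    proof (rule cINF_greatest)
      fix p assume "p \<in> ?S"
      then obtain a b c where p: "p = (a,b,c)" "a \<in> X" "b \<in> X" "c \<in> X" "nonstrict R a b c"
        by (auto simp: nonstrict_set_def)
      have "R z y x" using False not_nonstrict X by blast
      then have "R c b a" if "?f p < ?m"
        using that p(1-4) X commute by (intro move_all[of z y x c b a ?m]) auto
      then show "?m \<le> ?f p" using not_nonstrict p by fastforce
    qed (use S in auto)
    ultimately show ?thesis using False by (simp add: dc_def)
  qed
qed

lemma triangle: "x \<in> X \<Longrightarrow> y \<in> X \<Longrightarrow> z \<in> X \<Longrightarrow> d x z \<le> d x y + d y z"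
  using ultra[of x y z] nonneg[of x y] nonneg[of y z] by linarith

lemma dist_lipschitz:
  assumes "x \<in> X" "y \<in> X" "x' \<in> X" "y' \<in> X" "d x x' \<le> r" "d y y' \<le> r"
  shows "\<bar>d x y - d x' y'\<bar> \<le> 2 * r"
  using triangle[of x x' y] triangle[of x' y' y] triangle[of x' x y'] triangle[of x y y']
    assms commute[of x x'] commute[of y y'] by linarith

text \<open>When both triples are wrongly oriented, both values are minima of pairwise distances,
  each of which varies by at most \<open>2 * r\<close>. When only the first one is,
  \<open>move_all\<close> bounds its least pairwise distance by \<open>r\<close>.\<close>

lemma dc_lipschitz_le:
  assumes X: "x \<in> X" "y \<in> X" "z \<in> X" "x' \<in> X" "y' \<in> X" "z' \<in> X"
    and d: "d x x' \<le> r" "d y y' \<le> r" "d z z' \<le> r"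
  shows "dc x y z \<le> dc x' y' z' + 2 * r"
proof (cases "R z' y' x'")
  case True
  have "dc x y z \<le> min (d x y) (min (d y z) (d x z))"
    by (auto simp: dc_def nonneg)
  moreover have "dc x' y' z' = min (d x' y') (min (d y' z') (d x' z'))"
    using True not_nonstrict X by (auto simp: dc_def)
  ultimately show ?thesis
    using dist_lipschitz[of x y x' y' r] dist_lipschitz[of y z y' z' r] dist_lipschitz[of x z x' z' r] X d
    by linarith
next
  case False
  show ?thesis
  proof (cases "R z y x")
    case True
    define m where "m = min (d x y) (min (d y z) (d x z))"
    have "m \<le> d x y" "m \<le> d y z" "m \<le> d x z" by (auto simp: m_def)
    then have "\<not> r < m"
      using move_all[of z y x z' y' x' m] True False X d
        commute[of z y] commute[of y x] commute[of z x]
      by auto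
    moreover have "0 \<le> r" using d(1) nonneg[of x x'] by linarith
    ultimately show ?thesis using True False not_nonstrict X by (auto simp: dc_def m_def)
  next
    case F: False
    have "0 \<le> r" using d(1) nonneg[of x x'] by linarith
    then show ?thesis using F False not_nonstrict X by (auto simp: dc_def)
  qed
qed

lemma dc_lipschitz:
  assumes X: "x \<in> X" "y \<in> X" "z \<in> X" "x' \<in> X" "y' \<in> X" "z' \<in> X"
    and d: "d x x' \<le> r" "d y y' \<le> r" "d z z' \<le> r"
  shows "\<bar>dc x y z - dc x' y' z'\<bar> \<le> 2 * r"
  using dc_lipschitz_le[of x y z x' y' z' r] dc_lipschitz_le[of x' y' z' x y z r] assms
    commute[of x x'] commute[of y y'] commute[of z z'] by linarith

section \<open>Reversal of the orientation, and gaps of finite sets\<close>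

lemma reverse: "ultra_cyclic X d (\<lambda>x y z. R z y x)"
proof
  show "order_convex X (\<lambda>x y z. R z y x) {y \<in> X. d x y < r}" if "x \<in> X" for x r
    using ball_convex[OF that, of r] unfolding order_convex_def nonstrict_def by blast
  show "R w y x" if "x \<in> X" "y \<in> X" "z \<in> X" "w \<in> X" "R z y x" "R w z x" for x y z w
    using trans[of x w z y] rot'[of z y x] rot'[of w z x] rot[of x w y] that by blast
  show "R x z y" if "x \<in> X" "y \<in> X" "z \<in> X" "R z y x" for x y z
    using rot'[of z y x] that by simp
  show "\<not> R x y z" if "x \<in> X" "y \<in> X" "z \<in> X" "R z y x" for x y z
    using asym[of z y x] that by simp
  show "R z y x \<or> R x y z"
    if "x \<in> X" "y \<in> X" "z \<in> X" "x \<noteq> y" "y \<noteq> z" "z \<noteq> x" for x y z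
    using total[of x y z] that by blast
qed (fact nonneg commute zero ultra le_one | assumption)+

text \<open>The gap between \<open>p\<close> and \<open>q\<close> is found as the greatest and the least element of \<open>\<alpha> ` I\<close>
  in the linear order obtained by cutting the circle at \<open>c\<close>.\<close>

lemma ex_gap:
  assumes I: "finite I" "\<alpha> ` I \<subseteq> X" "inj_on \<alpha> I" "i \<in> I" "j \<in> I" "i \<noteq> j"
    and c: "c \<in> X" "c \<notin> \<alpha> ` I"
  obtains p q where "p \<in> I" "q \<in> I" "p \<noteq> q" "R (\<alpha> p) c (\<alpha> q)"
    "\<And>k. k \<in> I \<Longrightarrow> k = p \<or> k = q \<or> R (\<alpha> q) (\<alpha> k) (\<alpha> p)"
    "\<And>k. k \<in> I \<Longrightarrow> k = q \<or> R c (\<alpha> q) (\<alpha> k)"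
    "\<And>k. k \<in> I \<Longrightarrow> k = p \<or> R c (\<alpha> k) (\<alpha> p)"
proof -
  \<comment> \<open>The orientation \<open>T\<close> is left open so that the same induction,
    applied to the reversed order, also yields the other end of the gap.\<close>
  have least: "\<exists>q\<in>J. \<forall>k\<in>J. k = q \<or> T c (\<alpha> q) (\<alpha> k)"
    if J: "finite J" "J \<noteq> {}" "J \<subseteq> I"
      and T: "ultra_cyclic X d T" for T J
    using J
  proof (induction J rule: finite_ne_induct)
    case (insert x F)
    interpret T: ultra_cyclic X d T by fact
    obtain q where q: "q \<in> F" "\<forall>k\<in>F. k = q \<or> T c (\<alpha> q) (\<alpha> k)" using insert by auto
    have F: "x \<in> I" "F \<subseteq> I" using insert.prems by auto
    have X: "\<alpha> x \<in> X" "\<alpha> q \<in> X" "\<forall>k\<in>F. \<alpha> k \<in> X" using F q(1) I(2) by auto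
    have ne: "\<alpha> x \<noteq> \<alpha> q" using insert.hyps F q(1) I(3) by (metis inj_on_def subsetD)
    have nc: "c \<noteq> \<alpha> x" "c \<noteq> \<alpha> q" using F q(1) c by auto
    consider "T c (\<alpha> x) (\<alpha> q)" | "T (\<alpha> q) (\<alpha> x) c"
      using T.total[of c "\<alpha> x" "\<alpha> q"] X ne nc c by auto
    then show ?case
    proof cases
      case 1
      then have "\<forall>k\<in>F. T c (\<alpha> x) (\<alpha> k)" using q T.trans X c(1) by metis
      then show ?thesis by blast
    next
      case 2
      then have "T c (\<alpha> q) (\<alpha> x)" using T.rot'[of "\<alpha> q" "\<alpha> x" c] X c(1) by simp
      then show ?thesis using q by blast
    qed
  qed auto
  obtain q where q: "q \<in> I" "\<And>k. k \<in> I \<Longrightarrow> k = q \<or> R c (\<alpha> q) (\<alpha> k)"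
    using least[of I R] I ultra_cyclic_axioms by blast
  obtain p where p: "p \<in> I" "\<And>k. k \<in> I \<Longrightarrow> k = p \<or> R (\<alpha> k) (\<alpha> p) c"
    using least[of I "\<lambda>x y z. R z y x"] I reverse by blast
  have X: "\<alpha> k \<in> X" if "k \<in> I" for k using that I by auto
  have p': "k = p \<or> R c (\<alpha> k) (\<alpha> p)" if "k \<in> I" for k
    using p(2)[OF that] rot'[of "\<alpha> k" "\<alpha> p" c] that X c p(1) by auto
  \<comment> \<open>The existence of two indices enters here: a single point would be both the first
    and the last one seen from \<open>c\<close>.\<close>
  have pq: "p \<noteq> q"
  proof
    assume "p = q"
    obtain k where k: "k \<in> I" "k \<noteq> p" using I by metis
    have "R c (\<alpha> p) (\<alpha> k)" "R c (\<alpha> k) (\<alpha> p)" using p' q(2) k \<open>p = q\<close> by blast+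
    then show False using asym[of c "\<alpha> k" "\<alpha> p"] rot[of c "\<alpha> p" "\<alpha> k"] X k p(1) c(1) 
      by simp
  qed
  have 1: "R c (\<alpha> q) (\<alpha> p)" using q(2)[OF p(1)] pq by blast
  have 2: "R (\<alpha> q) (\<alpha> k) (\<alpha> p)" if k: "k \<in> I" "k \<noteq> p" "k \<noteq> q" for k
  proof -
    have "R c (\<alpha> q) (\<alpha> k)" "R c (\<alpha> k) (\<alpha> p)" using q p' k by blast+
    then have "R (\<alpha> k) c (\<alpha> q)" "R (\<alpha> k) (\<alpha> p) c"
      using rot[of c "\<alpha> k" "\<alpha> p"] rot'[of c "\<alpha> q" "\<alpha> k"] X c p(1) q(1) k by auto
    then have "R (\<alpha> k) (\<alpha> p) (\<alpha> q)" using trans[of "\<alpha> k" "\<alpha> p" c "\<alpha> q"] X c p(1) q(1) k by simp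
    then show ?thesis using rot'[of "\<alpha> k" "\<alpha> p" "\<alpha> q"] X p(1) q(1) k by simp
  qed
  have 3: "R (\<alpha> p) c (\<alpha> q)" using rot'[OF _ _ _ 1] X c p(1) q(1) by simp
  show thesis by (rule that[of p q]) (use p q p' pq 2 3 in auto)
qed

end

text \<open>Cutting the circle at \<open>c\<close> orders the indexed points in the same way as
  cutting it just before \<open>\<alpha> q\<close>, the first point after \<open>c\<close>. The
  latter order is expressed by triples of indexed points, so \<open>iso\<close> carries it over, and
  a point \<open>y\<close> in the gap from \<open>\<beta> p\<close> to \<open>\<beta> q\<close> cuts
  the second circle at the corresponding place.\<close>

lemma gap_order_transfer:
  assumes R: "ultra_cyclic X d R" and S: "ultra_cyclic Y e S"
    and I: "\<alpha> ` I \<subseteq> X" "\<beta> ` I \<subseteq> Y"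
    and iso: "\<And>i j k. i \<in> I \<Longrightarrow> j \<in> I \<Longrightarrow> k \<in> I \<Longrightarrow> R (\<alpha> i) (\<alpha> j) (\<alpha> k) \<Longrightarrow> S (\<beta> i) (\<beta> j) (\<beta> k)"
    and c: "c \<in> X" and pq: "p \<in> I" "q \<in> I"
    and gap: "\<And>k. k \<in> I \<Longrightarrow> k = p \<or> k = q \<or> R (\<alpha> q) (\<alpha> k) (\<alpha> p)"
    and q: "\<And>k. k \<in> I \<Longrightarrow> k = q \<or> R c (\<alpha> q) (\<alpha> k)"
    and y: "y \<in> Y" "S (\<beta> p) y (\<beta> q)"
    and ij: "i \<in> I" "j \<in> I" "R c (\<alpha> i) (\<alpha> j)"
  shows "S y (\<beta> i) (\<beta> j)"
proof -
  interpret R: ultra_cyclic X d R by fact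
  interpret S: ultra_cyclic Y e S by fact
  have X: "\<alpha> k \<in> X" and Y: "\<beta> k \<in> Y" if "k \<in> I" for k using that I by auto
  have ne: "i \<noteq> j" using R.distinct[OF _ _ _ ij(3)] X ij c by auto
  have jq: "j \<noteq> q"
  proof
    assume "j = q"
    then have "R c (\<alpha> j) (\<alpha> i)" using q[OF ij(1)] ne by blast
    then show False using R.asym[OF _ _ _ ij(3)] R.rot[of c "\<alpha> j" "\<alpha> i"] X c ij by simp
  qed
  have gap': "S (\<beta> q) (\<beta> k) y" if k: "k \<in> I" "k \<noteq> q" for k
  proof (cases "k = p")
    case True
    then show ?thesis using S.rot'[OF _ _ _ y(2)] y(1) Y pq by simp
  next
    case False
    then have "S (\<beta> q) (\<beta> k) (\<beta> p)" using gap iso k pq by blast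
    moreover have "S (\<beta> q) (\<beta> p) y" using S.rot'[OF _ _ _ y(2)] y(1) Y pq by simp
    ultimately show ?thesis using S.trans[of "\<beta> q" "\<beta> k" "\<beta> p" y] Y y k pq by simp
  qed
  show ?thesis
  proof (cases "i = q")
    case True
    then show ?thesis using S.rot'[OF _ _ _ gap'[OF ij(2) jq]] Y y ij by simp
  next
    case False
    have "R c (\<alpha> q) (\<alpha> i)" using q[OF ij(1)] False by blast
    then have "R (\<alpha> i) c (\<alpha> q)" using R.rot'[of c "\<alpha> q" "\<alpha> i"] X c ij pq by simp
    moreover have "R (\<alpha> i) (\<alpha> j) c" using R.rot[OF _ _ _ ij(3)] X c ij by simp
    ultimately have "R (\<alpha> i) (\<alpha> j) (\<alpha> q)"
      using R.trans[of "\<alpha> i" "\<alpha> j" c "\<alpha> q"] X c ij pq by simp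
    then have "S (\<beta> i) (\<beta> j) (\<beta> q)" using iso ij pq by blast
    then have "S (\<beta> j) (\<beta> q) (\<beta> i)" using S.rot[of "\<beta> i" "\<beta> j" "\<beta> q"] Y ij pq by simp
    moreover have "S (\<beta> j) y (\<beta> q)" using S.rot[OF _ _ _ gap'[OF ij(2) jq]] Y y ij pq by simp
    ultimately have "S (\<beta> j) y (\<beta> i)" using S.trans[of "\<beta> j" y "\<beta> q" "\<beta> i"] Y y ij pq by simp
    then show ?thesis using S.rot[of "\<beta> j" y "\<beta> i"] Y y ij by simp
  qed
qed


section \<open>Extending separated partial isomorphisms\<close>

text \<open>The approximate axioms in the form in which they are applied: the witness lies strictly
  inside a prescribed arc between \<open>u\<close> and \<open>v\<close>, at a distance from
  \<open>u\<close> in a prescribed open interval. \<open>ex_far\<close> is the instance of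
  \<open>DU\<close> at distance 1.\<close>

locale dense_ultra_cyclic = ultra_cyclic +
  assumes right_dense: "u \<in> X \<Longrightarrow> v \<in> X \<Longrightarrow> 0 \<le> s \<Longrightarrow> s < t \<Longrightarrow> t \<le> d u v \<Longrightarrow>
      \<exists>z\<in>X. R u z v \<and> s < d u z \<and> d u z < t"
    and left_dense: "u \<in> X \<Longrightarrow> v \<in> X \<Longrightarrow> 0 \<le> s \<Longrightarrow> s < t \<Longrightarrow> t \<le> d u v \<Longrightarrow>
      \<exists>z\<in>X. R v z u \<and> s < d u z \<and> d u z < t"
    and ex_far: "0 < \<epsilon> \<Longrightarrow> \<exists>x\<in>X. \<exists>y\<in>X. 1 - \<epsilon> < d x y"
begin

lemma reverse_dense: "dense_ultra_cyclic X d (\<lambda>x y z. R z y x)"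
proof -
  interpret rev: ultra_cyclic X d "\<lambda>x y z. R z y x" by (rule reverse)
  show ?thesis by unfold_locales (use right_dense left_dense ex_far in auto)
qed

end

lemma ex_subinterval_avoiding:
  fixes a b :: real
  assumes "finite F" "a < b"
  obtains a' b' where "a \<le> a'" "a' < b'" "b' \<le> b" "{a'<..<b'} \<inter> F = {}"
proof -
  define m where "m = Min (insert b {x \<in> F. a < x})"
  have "a < m" "m \<le> b" using assms by (auto simp: m_def)
  moreover have "{a<..<m} \<inter> F = {}" using assms by (auto simp: m_def)
  ultimately show thesis using that[of a m] by simp
qed

text \<open>The nearest point \<open>\<alpha> p\<close> controls all distances from
  \<open>c\<close>, so it is enough to place \<open>y\<close> in the corresponding gap at a suitable
  distance from \<open>\<beta> p\<close>. The density axiom does this as long as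
  \<open>\<beta> q\<close> is at least that far from \<open>\<beta> p\<close>, which is the purpose
  of \<open>wide\<close>.\<close>

lemma gap_extension:
  assumes "ultra_cyclic X d R" "dense_ultra_cyclic Y e S"
    and I: "finite I" "\<alpha> ` I \<subseteq> X" "\<beta> ` I \<subseteq> Y" and \<delta>: "0 < \<delta>"
    and dist: "\<And>i j. i \<in> I \<Longrightarrow> j \<in> I \<Longrightarrow> \<bar>d (\<alpha> i) (\<alpha> j) - e (\<beta> i) (\<beta> j)\<bar> \<le> \<delta>"
    and far: "i\<^sub>0 \<in> I" "j\<^sub>0 \<in> I" "1 - \<delta> < d (\<alpha> i\<^sub>0) (\<alpha> j\<^sub>0)"
    and c: "c \<in> X" and pq: "p \<in> I" "q \<in> I" and cpq: "R (\<alpha> p) c (\<alpha> q)"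
    and gap: "\<And>k. k \<in> I \<Longrightarrow> k = p \<or> k = q \<or> R (\<alpha> q) (\<alpha> k) (\<alpha> p)"
    and near: "\<And>k. k \<in> I \<Longrightarrow> d c (\<alpha> p) \<le> d c (\<alpha> k)" and c_far: "4 * \<delta> < d c (\<alpha> p)"
  shows "\<exists>y\<in>Y. S (\<beta> p) y (\<beta> q) \<and> (\<forall>k\<in>I. \<bar>d c (\<alpha> k) - e y (\<beta> k)\<bar> \<le> 3 * \<delta>)"
proof -
  interpret R: ultra_cyclic X d R by fact
  interpret S: dense_ultra_cyclic Y e S by fact
  define s where "s = d c (\<alpha> p)"
  have X: "\<alpha> k \<in> X" and Y: "\<beta> k \<in> Y" if "k \<in> I" for k using that I by auto
  have s: "4 * \<delta> < s" "s \<le> 1" using c_far R.le_one[OF c X[OF pq(1)]] by (auto simp: s_def)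
  have d0: "d (\<alpha> p) (\<alpha> p) = 0" using R.zero X pq by blast
  \<comment> \<open>By the ultrametric inequality \<open>\<alpha> p\<close> cannot be close to both
    far points, so one of the two serves as \<open>h\<close>.\<close>
  obtain h where h: "h \<in> I" "1 - \<delta> < d (\<alpha> p) (\<alpha> h)"
    using R.ultra[of "\<alpha> i\<^sub>0" "\<alpha> p" "\<alpha> j\<^sub>0"] R.commute[of "\<alpha> i\<^sub>0" "\<alpha> p"] far X pq(1)
    by (smt (verit))
  \<comment> \<open>Otherwise a ball around \<open>\<alpha> p\<close> would contain
    \<open>\<alpha> p\<close> and \<open>\<alpha> q\<close> but exclude \<open>c\<close> on one of
    the arcs between them and \<open>\<alpha> h\<close> on the other.\<close>
  have wide: "s \<le> d (\<alpha> p) (\<alpha> q) + \<delta>"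
  proof (rule ccontr)
    assume less: "\<not> s \<le> d (\<alpha> p) (\<alpha> q) + \<delta>"
    have "h \<noteq> p" using h(2) d0 s \<delta> by auto
    moreover have "h \<noteq> q" using h(2) less s by auto
    ultimately have "R (\<alpha> q) (\<alpha> h) (\<alpha> p)" using gap h by blast
    moreover have "d (\<alpha> p) (\<alpha> q) < min s (d (\<alpha> p) (\<alpha> h))" using less h(2) s \<delta> by auto
    moreover have "0 < min s (d (\<alpha> p) (\<alpha> h))" using h(2) s \<delta> by auto
    moreover have "s = d (\<alpha> p) c" unfolding s_def by (rule R.commute)
    ultimately show False
      using R.ball_not_separated[of "\<alpha> p" "\<alpha> p" "\<alpha> q" c "\<alpha> h" "min s (d (\<alpha> p) (\<alpha> h))"]
        cpq X pq h c d0 by auto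
  qed
  text \<open>Avoiding the finitely many distances already present makes every triangle with
    vertices \<open>y\<close> and \<open>\<beta> p\<close> isosceles in the expected way.\<close>
  obtain a b where ab: "s - 3 * \<delta> \<le> a" "a < b" "b \<le> s - 2 * \<delta>"
      "{a<..<b} \<inter> (\<lambda>k. e (\<beta> p) (\<beta> k)) ` I = {}"
    using ex_subinterval_avoiding[of "(\<lambda>k. e (\<beta> p) (\<beta> k)) ` I" "s - 3 * \<delta>" "s - 2 * \<delta>"] I \<delta>
    by auto
  \<comment> \<open>One \<open>\<delta>\<close> is lost in \<open>wide\<close> and another in
    passing to the second space, so the new distance has to stay below
    \<open>s - 2 * \<delta>\<close>. An interval of length \<open>\<delta>\<close> below this value
    leads to the error \<open>3 * \<delta>\<close>.\<close>
  have "s - 2 * \<delta> \<le> e (\<beta> p) (\<beta> q)" using wide dist[OF pq(1,2)] by linarith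
  then obtain y where y: "y \<in> Y" "S (\<beta> p) y (\<beta> q)" "a < e (\<beta> p) y" "e (\<beta> p) y < b"
    using S.right_dense[of "\<beta> p" "\<beta> q" a b] ab s Y pq \<delta> by auto
  have "\<bar>d c (\<alpha> k) - e y (\<beta> k)\<bar> \<le> 3 * \<delta>" if k: "k \<in> I" for k
  proof -
    have "e (\<beta> p) y \<noteq> e (\<beta> p) (\<beta> k)" using ab(4) y k by force
    then have "e y (\<beta> k) = max (e (\<beta> p) y) (e (\<beta> p) (\<beta> k))"
      using S.isosceles[of y "\<beta> p" "\<beta> k"] S.commute[of y "\<beta> p"] y Y k pq by simp
    moreover have "d c (\<alpha> k) = max s (d (\<alpha> p) (\<alpha> k))"
      unfolding s_def using R.nearest_dist near X c k pq by blast
    ultimately show ?thesis using dist[OF pq(1) k] y ab by linarith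
  qed
  then show ?thesis using y by blast
qed

text \<open>The gap around \<open>c\<close> determines the order of the new point, and the nearer
  end of the gap determines its distances. If this end is \<open>\<alpha> q\<close>, the orientation
  of both spaces is reversed.\<close>

lemma separated_extension:
  assumes R: "dense_ultra_cyclic X d R" and S: "dense_ultra_cyclic Y e S"
    and I: "finite I" "\<alpha> ` I \<subseteq> X" "\<beta> ` I \<subseteq> Y" and \<delta>: "0 < \<delta>" "\<delta> \<le> 1/2"
    and dist: "\<And>i j. i \<in> I \<Longrightarrow> j \<in> I \<Longrightarrow> \<bar>d (\<alpha> i) (\<alpha> j) - e (\<beta> i) (\<beta> j)\<bar> \<le> \<delta>"
    and sep: "\<And>i j. i \<in> I \<Longrightarrow> j \<in> I \<Longrightarrow> i \<noteq> j \<Longrightarrow> 4 * \<delta> < d (\<alpha> i) (\<alpha> j)"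
    and iso: "\<And>i j k. i \<in> I \<Longrightarrow> j \<in> I \<Longrightarrow> k \<in> I \<Longrightarrow> R (\<alpha> i) (\<alpha> j) (\<alpha> k) \<Longrightarrow> S (\<beta> i) (\<beta> j) (\<beta> k)"
    and far: "i\<^sub>0 \<in> I" "j\<^sub>0 \<in> I" "1 - \<delta> < d (\<alpha> i\<^sub>0) (\<alpha> j\<^sub>0)"
    and c: "c \<in> X" "\<And>k. k \<in> I \<Longrightarrow> 4 * \<delta> < d c (\<alpha> k)"
  shows "\<exists>y\<in>Y. (\<forall>k\<in>I. \<bar>d c (\<alpha> k) - e y (\<beta> k)\<bar> \<le> 3 * \<delta>) \<and>
     (\<forall>i\<in>I. \<forall>j\<in>I. R c (\<alpha> i) (\<alpha> j) \<longrightarrow> S y (\<beta> i) (\<beta> j))"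
proof -
  interpret R: dense_ultra_cyclic X d R by fact
  interpret S: dense_ultra_cyclic Y e S by fact
  have X: "\<alpha> k \<in> X" and Y: "\<beta> k \<in> Y" if "k \<in> I" for k using that I by auto
  have d0: "d x x = 0" if "x \<in> X" for x using R.zero that by blast
  have "i\<^sub>0 \<noteq> j\<^sub>0" using far d0 X \<delta> by auto
  moreover have "inj_on \<alpha> I"
  proof (rule inj_onI)
    show "i = j" if "i \<in> I" "j \<in> I" "\<alpha> i = \<alpha> j" for i j
      using sep[of i j] that d0[OF X] \<delta> by fastforce
  qed
  moreover have "c \<notin> \<alpha> ` I" using c(2) d0[OF c(1)] \<delta> by fastforce
  ultimately obtain p q where pq: "p \<in> I" "q \<in> I" "p \<noteq> q" "R (\<alpha> p) c (\<alpha> q)"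
    and gap: "\<And>k. k \<in> I \<Longrightarrow> k = p \<or> k = q \<or> R (\<alpha> q) (\<alpha> k) (\<alpha> p)"
    and q: "\<And>k. k \<in> I \<Longrightarrow> k = q \<or> R c (\<alpha> q) (\<alpha> k)"
    and p: "\<And>k. k \<in> I \<Longrightarrow> k = p \<or> R c (\<alpha> k) (\<alpha> p)"
    using R.ex_gap[OF I(1,2) _ far(1,2) _ c(1)] by metis
  \<comment> \<open>A point of the tuple closer to \<open>c\<close> than both ends of the gap would
    lie with \<open>c\<close> in a ball around \<open>c\<close>, while the ends lie outside this
    ball and on different arcs between the two.\<close>
  have nearest: "(\<forall>k\<in>I. d c (\<alpha> p) \<le> d c (\<alpha> k)) \<or> (\<forall>k\<in>I. d c (\<alpha> q) \<le> d c (\<alpha> k))"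
  proof -
    define r where "r = min (d c (\<alpha> p)) (d c (\<alpha> q))"
    have "r \<le> d c (\<alpha> k)" if k: "k \<in> I" for k
    proof (rule ccontr)
      assume less: "\<not> r \<le> d c (\<alpha> k)"
      then have "k \<noteq> p" "k \<noteq> q" by (auto simp: r_def)
      then have "R c (\<alpha> q) (\<alpha> k)" "R c (\<alpha> k) (\<alpha> p)" using p q k by blast+
      then have "R c (\<alpha> q) (\<alpha> k)" "R (\<alpha> k) (\<alpha> p) c"
        using R.rot[of c "\<alpha> k" "\<alpha> p"] X k pq c(1) by auto
      moreover have "0 < r" using c(2) pq \<delta> unfolding r_def by (smt (verit))
      ultimately show False
        using R.ball_not_separated[of c c "\<alpha> k" "\<alpha> q" "\<alpha> p" r] less X k pq c(1) d0[OF c(1)]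
        by (auto simp: r_def)
    qed
    then show ?thesis by (cases "d c (\<alpha> p) \<le> d c (\<alpha> q)") (simp_all add: r_def)
  qed
  have "\<exists>y\<in>Y. S (\<beta> p) y (\<beta> q) \<and> (\<forall>k\<in>I. \<bar>d c (\<alpha> k) - e y (\<beta> k)\<bar> \<le> 3 * \<delta>)"
    using nearest
  proof
    assume "\<forall>k\<in>I. d c (\<alpha> p) \<le> d c (\<alpha> k)"
    then show ?thesis
      using gap_extension[OF R.ultra_cyclic_axioms S I \<delta>(1) dist far c(1) pq(1,2,4) gap] c(2) pq(1)
      by blast
  next
    assume near: "\<forall>k\<in>I. d c (\<alpha> q) \<le> d c (\<alpha> k)"
    have gap': "k = q \<or> k = p \<or> R (\<alpha> q) (\<alpha> k) (\<alpha> p)" if "k \<in> I" for k using gap[OF that] by blast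
    show ?thesis
      using gap_extension[OF R.reverse S.reverse_dense I \<delta>(1) dist far c(1) pq(2,1,4) gap']
        c(2) near pq(2)
      by blast
  qed
  then obtain y where y: "y \<in> Y" "S (\<beta> p) y (\<beta> q)" "\<forall>k\<in>I. \<bar>d c (\<alpha> k) - e y (\<beta> k)\<bar> \<le> 3 * \<delta>"
    by blast
  have "S y (\<beta> i) (\<beta> j)" if "i \<in> I" "j \<in> I" "R c (\<alpha> i) (\<alpha> j)" for i j
    by (rule gap_order_transfer[OF R.ultra_cyclic_axioms S.ultra_cyclic_axioms I(2,3) iso c(1) pq(1,2) gap q y(1,2) that])
  then show ?thesis using y by blast
qed


section \<open>Approximate partial isomorphisms between models\<close>

text \<open>Order-convexity turns the approximate axioms into exact ones: the points
  \<open>x\<close> and \<open>y\<close> of a witness triple are so close to \<open>u\<close> and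
  \<open>v\<close> that replacing them by \<open>u\<close> and \<open>v\<close> preserves the
  orientation.\<close>

lemma UDCO_model_dense_ultra_cyclic:
  assumes "UDCO_model M"
  obtains R where "dense_ultra_cyclic (pts M) (dst M) R"
    "\<And>x y z. x \<in> pts M \<Longrightarrow> y \<in> pts M \<Longrightarrow> z \<in> pts M \<Longrightarrow>
       dcyc M x y z = ultra_cyclic.dc (dst M) R x y z"
proof -
  obtain R where M: "metric_cyclic_order M R" "DU_model M"
    and ax: "\<And>p. p \<in> \<rat> \<inter> {0<..<1} \<Longrightarrow> UDCO_axioms M R p"
    using assms unfolding UDCO_model_def by blast
  let ?X = "pts M" and ?d = "dst M"
  interpret Metric_space ?X ?d using M(1) by (simp add: metric_cyclic_order_def)
  have ne: "?X \<noteq> {}" and le1: "x \<in> ?X \<Longrightarrow> y \<in> ?X \<Longrightarrow> ?d x y \<le> 1"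
    and cyc: "strict_cyclic_order ?X R"
    and conv: "x \<in> ?X \<Longrightarrow> order_convex ?X R (mball x r)" for x y r
    using M(1) by (auto simp: metric_cyclic_order_def)
  have rot: "\<forall>a\<in>?X. \<forall>b\<in>?X. \<forall>c\<in>?X. R a b c \<longrightarrow> R b c a"
    and asym: "\<forall>a\<in>?X. \<forall>b\<in>?X. \<forall>c\<in>?X. R a b c \<longrightarrow> \<not> R c b a"
    and trans: "\<forall>a\<in>?X. \<forall>b\<in>?X. \<forall>c\<in>?X. \<forall>d\<in>?X. R a b c \<longrightarrow> R a c d \<longrightarrow> R a b d"
    and total: "\<forall>a\<in>?X. \<forall>b\<in>?X. \<forall>c\<in>?X. a \<noteq> b \<longrightarrow> b \<noteq> c \<longrightarrow> c \<noteq> a \<longrightarrow> R a b c \<or> R c b a"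
    using cyc unfolding strict_cyclic_order_def by - (elim conjE, assumption)+
  interpret ultra_cyclic ?X ?d R
  proof
    show "order_convex ?X R {y \<in> ?X. ?d x y < r}" if "x \<in> ?X" for x r
    proof -
      have "mball x r = {y \<in> ?X. ?d x y < r}" using that by auto
      then show ?thesis using conv[OF that, of r] by simp
    qed
    show "?d x z \<le> max (?d x y) (?d y z)" if "x \<in> ?X" "y \<in> ?X" "z \<in> ?X" for x y z
      using M(2) that by (auto simp: DU_model_def)
  qed (fact nonneg commute zero le1 rot[rule_format] asym[rule_format] trans[rule_format] total[rule_format])+
  define S where "S = nonstrict_set ?X R"
  have dc: "dcyc M x y z = dc x y z" if "x \<in> ?X" "y \<in> ?X" "z \<in> ?X" for x y z
    using M(1) dc_eq_INF[OF that] that unfolding metric_cyclic_order_def by simp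
  \<comment> \<open>A supremum of reals bounds its members only if the set is bounded above; the
    degenerate triple \<open>(u, v, u)\<close> bounds every infimum by 2.\<close>
  have appr: "\<exists>(x, y, z)\<in>S. f (u, v) (x, y, z) < \<epsilon>"
    if f: "(SUP w\<in>?X \<times> ?X. INF w'\<in>S. f w w') = 0" and bd: "\<And>w w'. 0 \<le> f w w'"
      and bd': "\<And>u v. u \<in> ?X \<Longrightarrow> v \<in> ?X \<Longrightarrow> f (u, v) (u, v, u) \<le> 2"
      and uv: "u \<in> ?X" "v \<in> ?X" and \<epsilon>: "0 < \<epsilon>" for f :: "_ \<Rightarrow> _ \<Rightarrow> real" and u v \<epsilon>
  proof -
    have bb: "bdd_below (f w ` S)" for w by (rule bdd_belowI[of _ 0]) (elim imageE, hypsubst, rule bd)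
    have "(INF w'\<in>S. f (u, v) w') \<le> 2" if w: "u \<in> ?X" "v \<in> ?X" for u v
    proof -
      have "(u, v, u) \<in> S" using w by (auto simp: S_def nonstrict_set_def nonstrict_def)
      then have "(INF w'\<in>S. f (u, v) w') \<le> f (u, v) (u, v, u)" by (rule cINF_lower[OF bb])
      also have "\<dots> \<le> 2" using bd' w by blast
      finally show ?thesis .
    qed
    then have "bdd_above ((\<lambda>w. INF w'\<in>S. f w w') ` (?X \<times> ?X))" by (intro bdd_aboveI[of _ 2]) auto
    from cSUP_upper[OF _ this, of "(u, v)"] have "(INF w'\<in>S. f (u, v) w') < \<epsilon>" using f uv \<epsilon> by auto
    moreover have "(u, v, u) \<in> S" using uv by (auto simp: S_def nonstrict_set_def nonstrict_def)
    ultimately show ?thesis using cINF_less_iff[OF _ bb] by fastforce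
  qed
  \<comment> \<open>The flag \<open>b\<close> selects the axiom: the first one at
    \<open>(u, v)\<close> or the second one at \<open>(v, u)\<close>. In both cases the distance of
    \<open>z\<close> is measured from \<open>u\<close>, but \<open>z\<close> falls on different
    arcs.\<close>
  have dense: "\<exists>z\<in>?X. (if b then R v u z else R u v z) \<and> s < ?d u z \<and> ?d u z < t"
    if uv: "u \<in> ?X" "v \<in> ?X" and st: "0 \<le> s" "s < t" "t \<le> ?d u v"  for u v s t b
  proof -
    define s' where "s' = (s + t) / 2"
    have s': "0 < s'" "s < s'" "s' < t" using st by (auto simp: s'_def)
    have D: "0 < ?d u v" using st by linarith
    obtain p where p: "p \<in> \<rat>" "s' / ?d u v < p" "p < t / ?d u v"
      using Rats_dense_in_real[of "s' / ?d u v" "t / ?d u v"] s' D by (auto simp: divide_strict_right_mono)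
    have pd: "s' < p * ?d u v" "p * ?d u v < t" using p D by (auto simp: field_simps)
    have p1: "p \<in> \<rat> \<inter> {0<..<1}"
    proof -
      have "0 < s' / ?d u v" "t / ?d u v \<le> 1" using s' D st by auto
      then show ?thesis using p by auto
    qed
    \<comment> \<open>Since \<open>p * dst M u v\<close> lies between the midpoint \<open>s'\<close>
      and \<open>t\<close>, these bounds keep \<open>dst M u z\<close> inside the interval and above
      \<open>\<epsilon>\<close>. Displacing \<open>u\<close> and \<open>v\<close> by less than
      \<open>\<epsilon>\<close> then changes none of the three distances.\<close>
    obtain \<epsilon> where "0 < \<epsilon>" "\<epsilon> < (t - s) / 4" "\<epsilon> < t - p * ?d u v" "\<epsilon> < s' / 2"
      using field_lbound_gt_zero[of "(t - s) / 4" "min (t - p * ?d u v) (s' / 2)"] pd s' st by auto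
    then have \<epsilon>: "0 < \<epsilon>" "\<epsilon> \<le> t - p * ?d u v" "2 * \<epsilon> \<le> s'" "4 * \<epsilon> \<le> t - s"
      by simp_all
    have p01: "0 \<le> p * x" "p * x \<le> 1" if "0 \<le> x" "x \<le> 1" for x
      using that p1 mult_le_one[of p x] by auto
    have d0: "?d x x = 0" if "x \<in> ?X" for x using that by simp
    have "\<exists>x y z. x \<in> ?X \<and> y \<in> ?X \<and> z \<in> ?X \<and> nonstrict R (if b then y else x) (if b then x else y) z \<and>
        ?d u x + ?d v y + \<bar>?d u z - p * ?d u v\<bar> < \<epsilon>"
    proof (cases b)
      case False
      let ?f = "\<lambda>(u, v) (x, y, z). ?d u x + ?d v y + \<bar>?d u z - p * ?d u v\<bar>"
      have "(SUP w\<in>?X \<times> ?X. INF w'\<in>S. ?f w w') = 0"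
        using ax[OF p1] by (simp add: UDCO_axioms_def S_def case_prod_beta')
      then have "\<exists>(x, y, z)\<in>S. ?f (u, v) (x, y, z) < \<epsilon>"
        by (rule appr) (use uv \<epsilon> p01 le1 in \<open>auto simp: d0 intro!: add_nonneg_nonneg\<close>, smt (verit) le1 nonneg p01)
      then show ?thesis using False by (auto simp: S_def nonstrict_set_def)
    next
      case True
      let ?f = "\<lambda>(u, v) (x, y, z). ?d u x + ?d v y + \<bar>?d v z - p * ?d u v\<bar>"
      have "(SUP w\<in>?X \<times> ?X. INF w'\<in>S. ?f w w') = 0"
        using ax[OF p1] by (simp add: UDCO_axioms_def S_def case_prod_beta')
      then have "\<exists>(x, y, z)\<in>S. ?f (v, u) (x, y, z) < \<epsilon>"
        by (rule appr) (use uv \<epsilon> p01 le1 in \<open>auto simp: d0 intro!: add_nonneg_nonneg\<close>, smt (verit) le1 nonneg p01 commute)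
      then obtain x y z where "x \<in> ?X" "y \<in> ?X" "z \<in> ?X" "nonstrict R x y z"
        "?d v x + ?d u y + \<bar>?d u z - p * ?d v u\<bar> < \<epsilon>" by (auto simp: S_def nonstrict_set_def)
      then show ?thesis using True commute[of u v]
        by (intro exI[of _ y] exI[of _ x] exI[of _ z]) auto
    qed
    then obtain x y z where X: "x \<in> ?X" "y \<in> ?X" "z \<in> ?X"
      and ns: "nonstrict R (if b then y else x) (if b then x else y) z"
      and lt: "?d u x + ?d v y + \<bar>?d u z - p * ?d u v\<bar> < \<epsilon>" by blast
    have small: "?d u x < \<epsilon>" "?d v y < \<epsilon>" "\<bar>?d u z - p * ?d u v\<bar> < \<epsilon>"
      using lt nonneg[of u x] nonneg[of v y] by linarith+
    have uz: "s < ?d u z" "?d u z < t" "\<epsilon> < ?d u z"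
    proof -
      show "?d u z < t" "\<epsilon> < ?d u z" using small \<epsilon> pd by linarith+
      show "s < ?d u z" using small pd \<epsilon>(4) by (simp add: s'_def)
    qed
    have vz: "?d v z = ?d u v"
      using isosceles[of v u z] commute[of u v] uv X uz st by auto
    have xz: "?d x z = ?d u z" "?d y z = ?d u v"
      using isosceles[of x u z] isosceles[of y v z] commute[of u x] commute[of v y] vz uv X uz small st by auto
    have "?d x v = ?d u v"
      using isosceles[of x u v] commute[of u x] uv X uz small st by auto
    then have xy: "?d x y = ?d u v"
      using isosceles[of x v y] uv X uz small st by auto
    have "x \<noteq> y" "y \<noteq> z" "z \<noteq> x" using xy xz uz st \<epsilon> d0 X by auto
    then have "if b then R y x z else R x y z" using ns by (auto simp: nonstrict_def split: if_splits)
    then have "if b then R v u z else R u v z"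
      using move_all[of y x z v u z \<epsilon>] move_all[of x y z u v z \<epsilon>] X uv small xy xz uz st \<epsilon>
        commute[of u x] commute[of v y] commute[of x y] d0[of z] by (auto split: if_splits)
    then show ?thesis using uz X by blast
  qed
  have "dense_ultra_cyclic ?X ?d R"
  proof
    fix u v s t
    assume uv: "u \<in> ?X" "v \<in> ?X" and st: "0 \<le> s" "s < t" "t \<le> ?d u v"
    obtain z where "z \<in> ?X" "R v u z" "s < ?d u z \<and> ?d u z < t" using dense[OF uv st, of True] by auto
    then show "\<exists>z\<in>?X. R u z v \<and> s < ?d u z \<and> ?d u z < t"
      using rot[of v u z] uv by blast
    obtain z where "z \<in> ?X" "R u v z" "s < ?d u z \<and> ?d u z < t" using dense[OF uv st, of False] by auto
    then show "\<exists>z\<in>?X. R v z u \<and> s < ?d u z \<and> ?d u z < t"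
      using rot[of u v z] uv by blast
  next
    fix \<epsilon> :: real assume \<epsilon>: "0 < \<epsilon>"
    obtain a where a: "a \<in> ?X" using ne by blast
    have "{0..1} \<subseteq> closure (?d a ` ?X)" using M(2) a by (auto simp: DU_model_def)
    then have "1 \<in> closure (?d a ` ?X)" by auto
    then obtain b where "b \<in> ?X" "dist (?d a b) 1 < \<epsilon>" using \<epsilon> unfolding closure_approachable by blast
    then show "\<exists>x\<in>?X. \<exists>y\<in>?X. 1 - \<epsilon> < ?d x y" using a by (intro bexI[of _ a] bexI[of _ b]) (auto simp: dist_real_def)
  qed
  then show thesis using that dc by blast
qed

section \<open>Nets, perturbation and the extension step\<close>

lemma ex_separated_net:
  fixes f :: "'a \<Rightarrow> 'a \<Rightarrow> real"
  assumes "finite P" and sym: "\<And>x y. f x y = f y x" and refl: "\<And>x. x \<in> P \<Longrightarrow> f x x \<le> \<tau>"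
  shows "\<exists>W\<subseteq>P. (\<forall>v\<in>W. \<forall>w\<in>W. v \<noteq> w \<longrightarrow> \<tau> < f v w) \<and> (\<forall>v\<in>P. \<exists>w\<in>W. f v w \<le> \<tau>)"
  using assms(1) refl
proof (induction P rule: finite_induct)
  case (insert x P)
  then obtain W where W: "W \<subseteq> P" "\<forall>v\<in>W. \<forall>w\<in>W. v \<noteq> w \<longrightarrow> \<tau> < f v w" "\<forall>v\<in>P. \<exists>w\<in>W. f v w \<le> \<tau>"
    by auto
  show ?case
  proof (cases "\<exists>w\<in>W. f x w \<le> \<tau>")
    case True
    then show ?thesis using W by (intro exI[of _ W]) auto
  next
    case False
    then have "\<forall>w\<in>W. \<tau> < f x w \<and> \<tau> < f w x" using sym[of x] by (auto simp: not_le)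
    then show ?thesis using W insert.prems by (intro exI[of _ "insert x W"]) auto
  qed
qed simp

text \<open>The atomic type of a pair of points does not tell which of the two arcs between them is
  short. Two points at distance almost \<open>1\<close> in the tuple decide this for all other pairs.\<close>

definition approx_iso :: "'a cyc_structure \<Rightarrow> 'b cyc_structure \<Rightarrow> real \<Rightarrow> ('a \<times> 'b) set \<Rightarrow> bool" where
  "approx_iso M N \<delta> P \<longleftrightarrow> finite P \<and> P \<subseteq> pts M \<times> pts N \<and>
     (\<forall>v\<in>P. \<forall>w\<in>P. \<bar>dst M (fst v) (fst w) - dst N (snd v) (snd w)\<bar> \<le> \<delta>) \<and>
     (\<forall>u\<in>P. \<forall>v\<in>P. \<forall>w\<in>P.
        \<bar>dcyc M (fst u) (fst v) (fst w) - dcyc N (snd u) (snd v) (snd w)\<bar> \<le> \<delta>) \<and>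
     (\<exists>v\<in>P. \<exists>w\<in>P. 1 - \<delta> < dst M (fst v) (fst w) \<and> 1 - \<delta> < dst N (snd v) (snd w))"

lemma approx_iso_mono:
  assumes "approx_iso M N \<delta> P" "\<delta> \<le> \<epsilon>"
  shows "approx_iso M N \<epsilon> P"
proof -
  have "t \<le> \<delta> \<Longrightarrow> t \<le> \<epsilon>" "1 - \<delta> < t \<Longrightarrow> 1 - \<epsilon> < t" for t using assms(2) by simp_all
  then show ?thesis using assms(1) unfolding approx_iso_def by meson
qed

lemma approx_iso_converse:
  assumes "approx_iso M N \<delta> P"
  shows "approx_iso N M \<delta> (P\<inverse>)"
proof -
  have "P\<inverse> = prod.swap ` P" by force
  then show ?thesis using assms unfolding approx_iso_def
    by (simp add: abs_minus_commute conj_commute image_subset_iff mem_Times_iff subset_iff)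
qed

text \<open>Moving points by at most \<open>r\<close> changes an atomic value by at most
  \<open>2 * r\<close> in each of the two structures, which accounts for \<open>4 * r\<close>. In
  this way an estimate for a thinned tuple returns to the full one.\<close>

lemma approx_iso_perturb:
  assumes R: "ultra_cyclic (pts M) (dst M) R" and S: "ultra_cyclic (pts N) (dst N) S"
    and M: "\<And>x y z. x \<in> pts M \<Longrightarrow> y \<in> pts M \<Longrightarrow> z \<in> pts M \<Longrightarrow> dcyc M x y z = ultra_cyclic.dc (dst M) R x y z"
    and N: "\<And>x y z. x \<in> pts N \<Longrightarrow> y \<in> pts N \<Longrightarrow> z \<in> pts N \<Longrightarrow> dcyc N x y z = ultra_cyclic.dc (dst N) S x y z"
    and P: "finite P" "P \<subseteq> pts M \<times> pts N" and Q: "Q \<subseteq> pts M \<times> pts N"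
    and near: "\<And>v. v \<in> P \<Longrightarrow> \<exists>w\<in>Q. dst M (fst v) (fst w) \<le> r \<and> dst N (snd v) (snd w) \<le> r"
    and dist: "\<And>v w. v \<in> Q \<Longrightarrow> w \<in> Q \<Longrightarrow> \<bar>dst M (fst v) (fst w) - dst N (snd v) (snd w)\<bar> \<le> s"
    and cyc: "\<And>u v w. u \<in> Q \<Longrightarrow> v \<in> Q \<Longrightarrow> w \<in> Q \<Longrightarrow>
        \<bar>dcyc M (fst u) (fst v) (fst w) - dcyc N (snd u) (snd v) (snd w)\<bar> \<le> s"
    and far: "\<exists>v\<in>P. \<exists>w\<in>P. 1 - (s + 4 * r) < dst M (fst v) (fst w) \<and> 1 - (s + 4 * r) < dst N (snd v) (snd w)"
  shows "approx_iso M N (s + 4 * r) P"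
proof -
  interpret R: ultra_cyclic "pts M" "dst M" R by fact
  interpret S: ultra_cyclic "pts N" "dst N" S by fact
  have PX: "fst v \<in> pts M" "snd v \<in> pts N" if "v \<in> P" for v using that P by auto
  have QX: "fst v \<in> pts M" "snd v \<in> pts N" if "v \<in> Q" for v using that Q by auto
  obtain g where g: "\<And>v. v \<in> P \<Longrightarrow> g v \<in> Q" "\<And>v. v \<in> P \<Longrightarrow> dst M (fst v) (fst (g v)) \<le> r"
      "\<And>v. v \<in> P \<Longrightarrow> dst N (snd v) (snd (g v)) \<le> r"
    using near by metis
  have "\<bar>dst M (fst v) (fst w) - dst N (snd v) (snd w)\<bar> \<le> s + 4 * r" if "v \<in> P" "w \<in> P" for v w
    using R.dist_lipschitz[of "fst v" "fst w" "fst (g v)" "fst (g w)" r]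
      S.dist_lipschitz[of "snd v" "snd w" "snd (g v)" "snd (g w)" r]
      dist[of "g v" "g w"] PX QX g that by (smt (verit))
  moreover have "\<bar>dcyc M (fst u) (fst v) (fst w) - dcyc N (snd u) (snd v) (snd w)\<bar> \<le> s + 4 * r"
    if "u \<in> P" "v \<in> P" "w \<in> P" for u v w
    using R.dc_lipschitz[of "fst u" "fst v" "fst w" "fst (g u)" "fst (g v)" "fst (g w)" r]
      S.dc_lipschitz[of "snd u" "snd v" "snd w" "snd (g u)" "snd (g v)" "snd (g w)" r]
      cyc[of "g u" "g v" "g w"] PX QX g that M N by (smt (verit))
  ultimately show ?thesis using P far unfolding approx_iso_def by blast
qed

text \<open>The factor 23 is \<open>3 + 4 * 5\<close>: an error \<open>3 * \<delta>\<close> for the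
  thinned tuple with the new point, and a perturbation by \<open>5 * \<delta>\<close>, counted four
  times, to recover all of \<open>P\<close>. The net has radius \<open>4 * \<delta>\<close> in
  \<open>M\<close>, and the discrepancy of distances makes this \<open>5 * \<delta>\<close> in
  \<open>N\<close>.\<close>

lemma approx_iso_extend:
  fixes M :: "'a cyc_structure" and N :: "'b cyc_structure"
  assumes M: "UDCO_model M" and N: "UDCO_model N" and P: "approx_iso M N \<delta> P"
    and \<delta>: "0 < \<delta>" "\<delta> \<le> 1/8" and c: "c \<in> pts M"
  shows "\<exists>y\<in>pts N. approx_iso M N (23 * \<delta>) (insert (c, y) P)"
proof -
  obtain R where R: "dense_ultra_cyclic (pts M) (dst M) R"
    and M': "\<And>x y z. x \<in> pts M \<Longrightarrow> y \<in> pts M \<Longrightarrow> z \<in> pts M \<Longrightarrow> dcyc M x y z = ultra_cyclic.dc (dst M) R x y z"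
    using UDCO_model_dense_ultra_cyclic[OF M] by metis
  obtain S where S: "dense_ultra_cyclic (pts N) (dst N) S"
    and N': "\<And>x y z. x \<in> pts N \<Longrightarrow> y \<in> pts N \<Longrightarrow> z \<in> pts N \<Longrightarrow> dcyc N x y z = ultra_cyclic.dc (dst N) S x y z"
    using UDCO_model_dense_ultra_cyclic[OF N] by metis
  interpret R: dense_ultra_cyclic "pts M" "dst M" R by fact
  interpret S: dense_ultra_cyclic "pts N" "dst N" S by fact
  have PX: "fst v \<in> pts M" "snd v \<in> pts N" if "v \<in> P" for v
    using that P by (auto simp: approx_iso_def)
  have dist: "\<bar>dst M (fst v) (fst w) - dst N (snd v) (snd w)\<bar> \<le> \<delta>" if "v \<in> P" "w \<in> P" for v w
    using that P by (auto simp: approx_iso_def)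
  have cyc: "\<bar>dcyc M (fst u) (fst v) (fst w) - dcyc N (snd u) (snd v) (snd w)\<bar> \<le> \<delta>"
    if "u \<in> P" "v \<in> P" "w \<in> P" for u v w
    using that P unfolding approx_iso_def by blast
  obtain v\<^sub>0 w\<^sub>0 where far: "v\<^sub>0 \<in> P" "w\<^sub>0 \<in> P" "1 - \<delta> < dst M (fst v\<^sub>0) (fst w\<^sub>0)"
      "1 - \<delta> < dst N (snd v\<^sub>0) (snd w\<^sub>0)"
    using P by (auto simp: approx_iso_def)
  have fin: "finite P" and Psub: "P \<subseteq> pts M \<times> pts N" using P by (simp_all add: approx_iso_def)
  have d0: "dst M x x = 0" if "x \<in> pts M" for x using R.zero that by blast
  have e0: "dst N x x = 0" if "x \<in> pts N" for x using S.zero that by blast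
  have "\<exists>W\<subseteq>P. (\<forall>v\<in>W. \<forall>w\<in>W. v \<noteq> w \<longrightarrow> 4 * \<delta> < dst M (fst v) (fst w)) \<and>
      (\<forall>v\<in>P. \<exists>w\<in>W. dst M (fst v) (fst w) \<le> 4 * \<delta>)"
  proof (rule ex_separated_net[OF fin])
    show "dst M (fst v) (fst w) = dst M (fst w) (fst v)" for v w :: "'a \<times> 'b" by (rule R.commute)
    show "dst M (fst v) (fst v) \<le> 4 * \<delta>" if "v \<in> P" for v using d0[OF PX(1)[OF that]] \<delta>(1) by simp
  qed
  then obtain W where W: "W \<subseteq> P"
    and W': "\<forall>v\<in>W. \<forall>w\<in>W. v \<noteq> w \<longrightarrow> 4 * \<delta> < dst M (fst v) (fst w)"
      "\<forall>v\<in>P. \<exists>w\<in>W. dst M (fst v) (fst w) \<le> 4 * \<delta>"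
    by (elim exE conjE)
  note sep = W'(1)[rule_format] and net = W'(2)[rule_format]
  have WP: "v \<in> P" if "v \<in> W" for v using W that by blast
  have net': "\<exists>w\<in>W. dst M (fst v) (fst w) \<le> 5 * \<delta> \<and> dst N (snd v) (snd w) \<le> 5 * \<delta>" if v: "v \<in> P" for v
  proof -
    obtain w where w: "w \<in> W" "dst M (fst v) (fst w) \<le> 4 * \<delta>" using net[OF v] by blast
    then show ?thesis using dist[OF v WP[OF w(1)]] \<delta> by (intro bexI[of _ w]) auto
  qed
  have combine: "approx_iso M N (23 * \<delta>) (insert (c, y) P)"
    if y: "y \<in> pts N" and Q: "W \<subseteq> Q" "Q \<subseteq> pts M \<times> pts N"
      and near: "\<exists>w\<in>Q. dst M c (fst w) \<le> 5 * \<delta> \<and> dst N y (snd w) \<le> 5 * \<delta>"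
      and distQ: "\<And>v w. v \<in> Q \<Longrightarrow> w \<in> Q \<Longrightarrow> \<bar>dst M (fst v) (fst w) - dst N (snd v) (snd w)\<bar> \<le> 3 * \<delta>"
      and cycQ: "\<And>u v w. u \<in> Q \<Longrightarrow> v \<in> Q \<Longrightarrow> w \<in> Q \<Longrightarrow>
        \<bar>dcyc M (fst u) (fst v) (fst w) - dcyc N (snd u) (snd v) (snd w)\<bar> \<le> 3 * \<delta>" for y Q
  proof -
    have "approx_iso M N (3 * \<delta> + 4 * (5 * \<delta>)) (insert (c, y) P)"
    proof (rule approx_iso_perturb[OF R.ultra_cyclic_axioms S.ultra_cyclic_axioms M' N' _ _ Q(2) _ distQ cycQ])
      show "finite (insert (c, y) P)" using fin by simp
      show "insert (c, y) P \<subseteq> pts M \<times> pts N" using y c P by (auto simp: approx_iso_def)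
      show "\<exists>w\<in>Q. dst M (fst v) (fst w) \<le> 5 * \<delta> \<and> dst N (snd v) (snd w) \<le> 5 * \<delta>"
        if "v \<in> insert (c, y) P" for v
      proof (cases "v = (c, y)")
        case False
        then obtain w where "w \<in> W" "dst M (fst v) (fst w) \<le> 5 * \<delta> \<and> dst N (snd v) (snd w) \<le> 5 * \<delta>"
          using \<open>v \<in> insert (c, y) P\<close> net'[of v] by auto
        then show ?thesis using Q(1) by (intro bexI[of _ w]) auto
      qed (use near in simp)
      show "\<exists>v\<in>insert (c, y) P. \<exists>w\<in>insert (c, y) P. 1 - (3 * \<delta> + 4 * (5 * \<delta>)) < dst M (fst v) (fst w) \<and>
         1 - (3 * \<delta> + 4 * (5 * \<delta>)) < dst N (snd v) (snd w)"
        using far \<delta> by (intro bexI[of _ v\<^sub>0] bexI[of _ w\<^sub>0]) auto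
    qed
    then show ?thesis by simp
  qed
  show ?thesis
  proof (cases "\<exists>w\<in>W. dst M c (fst w) \<le> 4 * \<delta>")
    case True
    then obtain w where w: "w \<in> W" "dst M c (fst w) \<le> 4 * \<delta>" by blast
    \<comment> \<open>A point close to the net is sent to the partner of its net point.\<close>
    have "approx_iso M N (23 * \<delta>) (insert (c, snd w) P)"
    proof (rule combine[of "snd w" W])
      show "\<exists>v\<in>W. dst M c (fst v) \<le> 5 * \<delta> \<and> dst N (snd w) (snd v) \<le> 5 * \<delta>"
        using w \<delta> e0[OF PX(2)[OF WP[OF w(1)]]] by (intro bexI[of _ w]) auto
      show "\<bar>dst M (fst v) (fst w) - dst N (snd v) (snd w)\<bar> \<le> 3 * \<delta>" if "v \<in> W" "w \<in> W" for v w
        using dist[of v w] WP that \<delta> by fastforce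
      show "\<bar>dcyc M (fst u) (fst v) (fst w) - dcyc N (snd u) (snd v) (snd w)\<bar> \<le> 3 * \<delta>"
        if "u \<in> W" "v \<in> W" "w \<in> W" for u v w
        using cyc[of u v w] WP that \<delta> by fastforce
      show "W \<subseteq> pts M \<times> pts N" using W Psub by auto
    qed (use w WP PX in auto)
    then show ?thesis using PX WP w by blast
  next
    case False
    then have cfar: "4 * \<delta> < dst M c (fst w)" if "w \<in> W" for w using that by fastforce
    \<comment> \<open>The orientation is read off from the reversed triple: its cyclic distance in
      \<open>M\<close> is its least pairwise distance, which exceeds \<open>4 * \<delta>\<close>, so
      its cyclic distance in \<open>N\<close> is still positive.\<close>
    have isoW: "S (snd u) (snd v) (snd w)"
      if W: "u \<in> W" "v \<in> W" "w \<in> W" and Ruvw: "R (fst u) (fst v) (fst w)" for u v w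
    proof -
      have X: "fst u \<in> pts M" "fst v \<in> pts M" "fst w \<in> pts M"
        "snd u \<in> pts N" "snd v \<in> pts N" "snd w \<in> pts N" using W WP PX by auto
      have "u \<noteq> v" "v \<noteq> w" "u \<noteq> w" using R.distinct[OF X(1-3) Ruvw] by auto
      then have "\<delta> < min (dst M (fst w) (fst v)) (min (dst M (fst v) (fst u)) (dst M (fst w) (fst u)))"
        using sep[of w v] sep[of v u] sep[of w u] W \<delta> by auto
      moreover have "\<not> nonstrict R (fst w) (fst v) (fst u)" using R.not_nonstrict X Ruvw by blast
      ultimately have "\<delta> < dcyc M (fst w) (fst v) (fst u)" using M' X by (simp add: R.dc_def)
      then have "dcyc N (snd w) (snd v) (snd u) > 0" using cyc[of w v u] W WP by (smt (verit))
      then have "\<not> nonstrict S (snd w) (snd v) (snd u)" using N' X by (auto simp: S.dc_def split: if_splits)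
      then show ?thesis using S.not_nonstrict X by blast
    qed
    have "\<exists>y\<in>pts N. (\<forall>k\<in>W. \<bar>dst M c (fst k) - dst N y (snd k)\<bar> \<le> 3 * \<delta>) \<and>
       (\<forall>i\<in>W. \<forall>j\<in>W. R c (fst i) (fst j) \<longrightarrow> S y (snd i) (snd j))"
    proof -
      \<comment> \<open>Thinning may have removed the far pair. The net points replacing it are just
        as far apart, because \<open>4 * \<delta>\<close> is smaller than
        \<open>1 - \<delta>\<close>.\<close>
      obtain v w where vw: "v \<in> W" "dst M (fst v\<^sub>0) (fst v) \<le> 4 * \<delta>" "w \<in> W" "dst M (fst w\<^sub>0) (fst w) \<le> 4 * \<delta>"
        using net far(1,2) by meson
      have "1 - \<delta> < dst M (fst v) (fst w)"
        using R.ultra[of "fst v\<^sub>0" "fst v" "fst w\<^sub>0"] R.ultra[of "fst v" "fst w" "fst w\<^sub>0"]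
          R.commute[of "fst w" "fst w\<^sub>0"] vw(2,4) far(3) \<delta>
          PX(1)[OF far(1)] PX(1)[OF far(2)] PX(1)[OF WP[OF vw(1)]] PX(1)[OF WP[OF vw(3)]]
        by linarith
      then show ?thesis
        by (intro separated_extension[where \<alpha> = fst and \<beta> = snd,
              OF R S finite_subset[OF W fin] _ _ \<delta>(1) _ _ sep isoW vw(1,3) _ c cfar])
          (use PX[OF WP] dist[OF WP WP] \<delta>(2) in \<open>simp_all add: image_subset_iff\<close>)
    qed
    then obtain y where y: "y \<in> pts N" "\<And>k. k \<in> W \<Longrightarrow> \<bar>dst M c (fst k) - dst N y (snd k)\<bar> \<le> 3 * \<delta>"
      "\<And>i j. i \<in> W \<Longrightarrow> j \<in> W \<Longrightarrow> R c (fst i) (fst j) \<Longrightarrow> S y (snd i) (snd j)" by blast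
    let ?Q = "insert (c, y) W"
    have QX: "fst v \<in> pts M" "snd v \<in> pts N" if "v \<in> ?Q" for v using that PX[OF WP, of v] c y(1) by auto
    have distQ: "\<bar>dst M (fst v) (fst w) - dst N (snd v) (snd w)\<bar> \<le> 3 * \<delta>" if "v \<in> ?Q" "w \<in> ?Q" for v w
    proof -
      have "\<bar>dst M (fst v) (fst w) - dst N (snd v) (snd w)\<bar> \<le> 3 * \<delta>" if "v \<in> W" "w \<in> W" for v w
        using dist[of v w] WP that \<delta> by fastforce
      then show ?thesis using that y(2)[of v] y(2)[of w] R.commute[of "fst v" c] S.commute[of "snd v" y]
          d0[OF c] e0[OF y(1)] \<delta>(1) by auto
    qed
    have inj: "fst v \<noteq> fst w" if "v \<in> ?Q" "w \<in> ?Q" "v \<noteq> w" for v w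
    proof -
      have "4 * \<delta> < dst M (fst v) (fst w)"
        using that sep[of v w] cfar[of v] cfar[of w] R.commute[of "fst v" c] by auto
      then have "0 < dst M (fst v) (fst w)" using \<delta>(1) by linarith
      then show ?thesis using d0[OF QX(1)[OF that(1)]] by auto
    qed
    have iso: "S (snd u) (snd v) (snd w)"
      if Q: "u \<in> ?Q" "v \<in> ?Q" "w \<in> ?Q" and Ruvw: "R (fst u) (fst v) (fst w)" for u v w
    proof -
      note X = QX[OF Q(1)] QX[OF Q(2)] QX[OF Q(3)]
      have ne: "u \<noteq> v" "v \<noteq> w" "u \<noteq> w" using R.distinct[OF X(1,3,5) Ruvw] by auto
      consider "u = (c, y)" "v \<in> W" "w \<in> W" | "v = (c, y)" "w \<in> W" "u \<in> W"
        | "w = (c, y)" "u \<in> W" "v \<in> W" | "u \<in> W" "v \<in> W" "w \<in> W" using Q ne by blast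
      then show ?thesis
      proof cases
        case 1
        then show ?thesis using y(3) Ruvw by simp
      next
        case 2
        have "R (fst v) (fst w) (fst u)" using R.rot[OF X(1,3,5) Ruvw] .
        then have "S (snd v) (snd w) (snd u)" using y(3) 2 by simp
        then show ?thesis using S.rot'[OF X(4,6,2)] by blast
      next
        case 3
        have "R (fst w) (fst u) (fst v)" using R.rot'[OF X(1,3,5) Ruvw] .
        then have "S (snd w) (snd u) (snd v)" using y(3) 3 by simp
        then show ?thesis using S.rot[OF X(6,2,4)] by blast
      next
        case 4
        then show ?thesis using isoW Ruvw by blast
      qed
    qed
    have cycQ: "\<bar>dcyc M (fst u) (fst v) (fst w) - dcyc N (snd u) (snd v) (snd w)\<bar> \<le> 3 * \<delta>"
      if Q: "u \<in> ?Q" "v \<in> ?Q" "w \<in> ?Q" for u v w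
    proof -
      note X = QX[OF Q(1)] QX[OF Q(2)] QX[OF Q(3)]
      \<comment> \<open>One direction of preservation gives the equivalence, because the order is
        total and distinct pairs have distinct first components. The two cyclic distances are then
        both zero or both minima of corresponding distances, and taking minima does not increase the
        error.\<close>
      have "nonstrict R (fst u) (fst v) (fst w) \<longleftrightarrow> nonstrict S (snd u) (snd v) (snd w)"
      proof (cases "R (fst w) (fst v) (fst u)")
        case True
        then show ?thesis
          using iso[OF Q(3,2,1)] R.not_nonstrict[OF X(1,3,5)] S.not_nonstrict[OF X(2,4,6)] by blast
      next
        case False
        moreover have "\<not> S (snd w) (snd v) (snd u)"
        proof
          assume A: "S (snd w) (snd v) (snd u)"
          have "u \<noteq> v" "v \<noteq> w" "u \<noteq> w" using S.distinct[OF X(6,4,2) A] by auto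
          then have "R (fst u) (fst v) (fst w)"
            using R.total[OF X(1,3,5)] False inj[OF Q(1,2)] inj[OF Q(2,3)] inj[OF Q(1,3)] by auto
          then show False using iso[OF Q] S.asym[OF X(6,4,2) A] by blast
        qed
        ultimately show ?thesis
          using R.not_nonstrict[OF X(1,3,5)] S.not_nonstrict[OF X(2,4,6)] by blast
      qed
      moreover have min: "\<bar>min a b - min a' b'\<bar> \<le> t" if "\<bar>a - a'\<bar> \<le> t" "\<bar>b - b'\<bar> \<le> t"
        for a b a' b' t :: real using that by linarith
      ultimately show ?thesis
        using min[OF distQ[OF Q(1,2)] min[OF distQ[OF Q(2,3)] distQ[OF Q(1,3)]]] \<delta>(1)
        unfolding M'[OF X(1,3,5)] N'[OF X(2,4,6)] R.dc_def S.dc_def by simp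
    qed
    have "approx_iso M N (23 * \<delta>) (insert (c, y) P)"
    proof (rule combine[OF y(1) _ _ _ distQ cycQ])
      show "\<exists>w\<in>?Q. dst M c (fst w) \<le> 5 * \<delta> \<and> dst N y (snd w) \<le> 5 * \<delta>"
        using d0[OF c] e0[OF y(1)] \<delta>(1) by (intro bexI[of _ "(c, y)"]) auto
      show "?Q \<subseteq> pts M \<times> pts N" using c y(1) W Psub by auto
    qed auto
    then show ?thesis using y(1) by blast
  qed
qed


section \<open>Values of formulas\<close>

text \<open>The cube is a product of the compact factors \<open>{0..1}\<close> below
  \<open>n\<close> and \<open>{0}\<close> from \<open>n\<close> on, so Tychonoff's theorem
  applies.\<close>

lemma compact_cube: "compact (cube n)"
proof -
  let ?C = "\<lambda>i. if i < n then {0..1} else {0::real}"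
  have "cube n = PiE UNIV ?C"
  proof (intro set_eqI iffI)
    fix x assume "x \<in> cube n"
    then show "x \<in> PiE UNIV ?C" by (simp add: cube_def PiE_iff)
  next
    fix x assume x: "x \<in> PiE UNIV ?C"
    then have "x i \<in> ?C i" for i by (rule PiE_mem) simp
    then have "i < n \<Longrightarrow> x i \<in> {0..1}" "n \<le> i \<Longrightarrow> x i = 0" for i
      by (metis, metis leD singletonD)
    then show "x \<in> cube n" by (simp add: cube_def)
  qed
  moreover have "compactin (product_topology (\<lambda>_. euclidean) UNIV) (PiE UNIV ?C)"
    unfolding compactin_PiE by simp
  ultimately have "compactin euclidean (cube n)"
    by (simp only: euclidean_product_topology)
  then show ?thesis by (simp only: compactin_euclidean_iff)
qed

lemma connective_uniformly_continuous:
  assumes u: "connective n u" and \<epsilon>: "0 < \<epsilon>"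
  obtains \<delta> where "0 < \<delta>"
    "\<And>x y. x \<in> cube n \<Longrightarrow> y \<in> cube n \<Longrightarrow> (\<And>i. i < n \<Longrightarrow> \<bar>x i - y i\<bar> \<le> \<delta>) \<Longrightarrow> \<bar>u x - u y\<bar> \<le> \<epsilon>"
proof -
  have "uniformly_continuous_on (cube n) u"
    using u by (intro compact_uniformly_continuous compact_cube) (simp add: connective_def)
  then obtain \<eta> where \<eta>: "0 < \<eta>"
      "\<And>x y. x \<in> cube n \<Longrightarrow> y \<in> cube n \<Longrightarrow> dist x y < \<eta> \<Longrightarrow> dist (u x) (u y) < \<epsilon>"
    using \<epsilon> unfolding uniformly_continuous_on_def by metis
  \<comment> \<open>In the product metric the coordinates beyond \<open>N\<close> contribute at most
    \<open>(1/2) ^ N\<close> and the others at most twice their largest difference;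
    \<open>2 * (\<eta> / 8) + \<eta> / 2\<close> stays below \<open>\<eta>\<close>.\<close>
  obtain N where N: "(1/2::real) ^ N < \<eta> / 2"
    using real_arch_pow_inv[of "\<eta> / 2" "1/2"] \<eta> by auto
  show thesis
  proof (rule that[of "\<eta> / 8"])
    show "0 < \<eta> / 8" using \<eta> by simp
    fix x y assume xy: "x \<in> cube n" "y \<in> cube n" and le: "\<And>i. i < n \<Longrightarrow> \<bar>x i - y i\<bar> \<le> \<eta> / 8"
    have "\<bar>x i - y i\<bar> \<le> \<eta> / 8" for i
      using le[of i] xy \<eta>(1) by (cases "i < n") (auto simp: cube_def)
    then have "Max {dist (x (from_nat k)) (y (from_nat k)) |k. k \<le> N} \<le> \<eta> / 8"
      by (subst Max_le_iff) (auto simp: dist_real_def)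
    then have "dist x y \<le> 2 * (\<eta> / 8) + (1/2) ^ N"
      using dist_fun_le_dist_first_terms[of x y N] by linarith
    then have "dist x y < \<eta>" using N \<eta>(1) by linarith
    then show "\<bar>u x - u y\<bar> \<le> \<epsilon>" using \<eta>(2)[OF xy] by (simp add: dist_real_def)
  qed
qed

lemma SUP_INF_diff_le:
  fixes f :: "'a \<Rightarrow> real" and g :: "'b \<Rightarrow> real"
  assumes "A \<noteq> {}" "B \<noteq> {}"
    and f: "\<And>a. a \<in> A \<Longrightarrow> f a \<in> {0..1}" and g: "\<And>b. b \<in> B \<Longrightarrow> g b \<in> {0..1}"
    and forth: "\<And>a. a \<in> A \<Longrightarrow> \<exists>b\<in>B. \<bar>f a - g b\<bar> \<le> \<epsilon>"
    and backw: "\<And>b. b \<in> B \<Longrightarrow> \<exists>a\<in>A. \<bar>f a - g b\<bar> \<le> \<epsilon>"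
  shows "\<bar>(SUP a\<in>A. f a) - (SUP b\<in>B. g b)\<bar> \<le> \<epsilon>" "\<bar>(INF a\<in>A. f a) - (INF b\<in>B. g b)\<bar> \<le> \<epsilon>"
proof -
  have bf: "bdd_above (f ` A)" "bdd_below (f ` A)" and bg: "bdd_above (g ` B)" "bdd_below (g ` B)"
    using f g by (auto intro!: bdd_aboveI[of _ 1] bdd_belowI[of _ 0])
  have "(SUP a\<in>A. f a) \<le> (SUP b\<in>B. g b) + \<epsilon>"
  proof (rule cSUP_least[OF assms(1)])
    fix a assume "a \<in> A"
    then obtain b where "b \<in> B" "\<bar>f a - g b\<bar> \<le> \<epsilon>" using forth by blast
    then show "f a \<le> (SUP b\<in>B. g b) + \<epsilon>" using cSUP_upper[OF _ bg(1), of b] by linarith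
  qed
  moreover have "(SUP b\<in>B. g b) \<le> (SUP a\<in>A. f a) + \<epsilon>"
  proof (rule cSUP_least[OF assms(2)])
    fix b assume "b \<in> B"
    then obtain a where "a \<in> A" "\<bar>f a - g b\<bar> \<le> \<epsilon>" using backw by blast
    then show "g b \<le> (SUP a\<in>A. f a) + \<epsilon>" using cSUP_upper[OF _ bf(1), of a] by linarith
  qed
  ultimately show "\<bar>(SUP a\<in>A. f a) - (SUP b\<in>B. g b)\<bar> \<le> \<epsilon>" by linarith
  have "(INF a\<in>A. f a) - \<epsilon> \<le> (INF b\<in>B. g b)"
  proof (rule cINF_greatest[OF assms(2)])
    fix b assume "b \<in> B"
    then obtain a where "a \<in> A" "\<bar>f a - g b\<bar> \<le> \<epsilon>" using backw by blast
    then show "(INF a\<in>A. f a) - \<epsilon> \<le> g b" using cINF_lower[OF bf(2), of a] by linarith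
  qed
  moreover have "(INF b\<in>B. g b) - \<epsilon> \<le> (INF a\<in>A. f a)"
  proof (rule cINF_greatest[OF assms(1)])
    fix a assume "a \<in> A"
    then obtain b where "b \<in> B" "\<bar>f a - g b\<bar> \<le> \<epsilon>" using forth by blast
    then show "(INF b\<in>B. g b) - \<epsilon> \<le> f a" using cINF_lower[OF bg(2), of b] by linarith
  qed
  ultimately show "\<bar>(INF a\<in>A. f a) - (INF b\<in>B. g b)\<bar> \<le> \<epsilon>" by linarith
qed

lemma UDCO_model_nonempty: "UDCO_model M \<Longrightarrow> pts M \<noteq> {}"
  by (auto simp: UDCO_model_def metric_cyclic_order_def)

lemma SUP_INF_in_unit:
  fixes f :: "'a \<Rightarrow> real"
  assumes "A \<noteq> {}" "\<And>a. a \<in> A \<Longrightarrow> f a \<in> {0..1}"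
  shows "(SUP a\<in>A. f a) \<in> {0..1}" "(INF a\<in>A. f a) \<in> {0..1}"
proof -
  have b: "bdd_above (f ` A)" "bdd_below (f ` A)"
    using assms(2) by (auto intro!: bdd_aboveI[of _ 1] bdd_belowI[of _ 0])
  obtain a where a: "a \<in> A" using assms(1) by blast
  have "(SUP a\<in>A. f a) \<le> 1" "0 \<le> (INF a\<in>A. f a)"
    using assms by (auto intro!: cSUP_least cINF_greatest)
  moreover have "f a \<le> (SUP a\<in>A. f a)" "(INF a\<in>A. f a) \<le> f a"
    using cSUP_upper[OF a b(1)] cINF_lower[OF b(2) a] .
  ultimately show "(SUP a\<in>A. f a) \<in> {0..1}" "(INF a\<in>A. f a) \<in> {0..1}"
    using assms(2)[OF a] by auto
qed

text \<open>Boundedness gives the real suprema and infima of quantified formulas their meaning, and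
  it puts the arguments of a connective into the cube, where its continuity is assumed.\<close>

lemma val_in_unit:
  assumes M: "UDCO_model M"
  shows "wf_fm \<phi> \<Longrightarrow> range e \<subseteq> pts M \<Longrightarrow> val M \<phi> e \<in> {0..1}"
proof (induction \<phi> arbitrary: e)
  case (FDist i j)
  then have "e i \<in> pts M" "e j \<in> pts M" by auto
  moreover obtain R where "dense_ultra_cyclic (pts M) (dst M) R"
    using UDCO_model_dense_ultra_cyclic[OF M] by metis
  then interpret dense_ultra_cyclic "pts M" "dst M" R .
  show ?case using nonneg le_one calculation by simp
next
  case (FCyc i j k)
  then have X: "e i \<in> pts M" "e j \<in> pts M" "e k \<in> pts M" by auto
  obtain R where R: "dense_ultra_cyclic (pts M) (dst M) R"
    and dc: "dcyc M (e i) (e j) (e k) = ultra_cyclic.dc (dst M) R (e i) (e j) (e k)"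
    using UDCO_model_dense_ultra_cyclic[OF M] X by metis
  interpret dense_ultra_cyclic "pts M" "dst M" R by fact
  show ?case using nonneg le_one X by (simp add: dc dc_def min_le_iff_disj)
next
  case (FConn u \<phi>s)
  have "(\<lambda>i. if i < length \<phi>s then map (\<lambda>\<phi>. val M \<phi> e) \<phi>s ! i else 0) \<in> cube (length \<phi>s)"
    unfolding cube_def using FConn.IH FConn.prems by simp
  then show ?case using FConn.prems by (auto simp: connective_def)
next
  case (FSup i \<phi>)
  then have "val M \<phi> (e(i := a)) \<in> {0..1}" if "a \<in> pts M" for a
    using that by (intro FSup.IH) auto
  then show ?case using SUP_INF_in_unit[OF UDCO_model_nonempty[OF M]] by simp
next
  case (FInf i \<phi>)
  then have "val M \<phi> (e(i := a)) \<in> {0..1}" if "a \<in> pts M" for a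
    using that by (intro FInf.IH) auto
  then show ?case using SUP_INF_in_unit[OF UDCO_model_nonempty[OF M]] by simp
qed

section \<open>The back-and-forth induction on formulas\<close>

lemma approx_iso_atomic:
  assumes P: "approx_iso M N \<delta> P" and "(x, x') \<in> P" "(y, y') \<in> P"
  shows approx_iso_dst: "\<bar>dst M x y - dst N x' y'\<bar> \<le> \<delta>"
    and approx_iso_dcyc: "(z, z') \<in> P \<Longrightarrow> \<bar>dcyc M x y z - dcyc N x' y' z'\<bar> \<le> \<delta>"
proof -
  have "\<forall>v\<in>P. \<forall>w\<in>P. \<bar>dst M (fst v) (fst w) - dst N (snd v) (snd w)\<bar> \<le> \<delta>"
    and cyc: "\<forall>u\<in>P. \<forall>v\<in>P. \<forall>w\<in>P.
        \<bar>dcyc M (fst u) (fst v) (fst w) - dcyc N (snd u) (snd v) (snd w)\<bar> \<le> \<delta>"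
    using P unfolding approx_iso_def by - (elim conjE, assumption)+
  from this(1)[rule_format, OF assms(2,3)] show "\<bar>dst M x y - dst N x' y'\<bar> \<le> \<delta>" by simp
  show "(z, z') \<in> P \<Longrightarrow> \<bar>dcyc M x y z - dcyc N x' y' z'\<bar> \<le> \<delta>"
    using cyc[rule_format, OF assms(2,3), of "(z, z')"] by simp
qed

text \<open>An extension step costs the factor 23 and requires an error of at most
  \<open>1/8\<close>, hence the tolerance \<open>min (\<delta> / 23) (1/8)\<close>. Points of
  \<open>N\<close> are answered by extending the converse relation.\<close>

lemma approx_iso_quantifier:
  fixes M :: "'a cyc_structure" and N :: "'b cyc_structure"
  assumes M: "UDCO_model M" and N: "UDCO_model N" and wf: "wf_fm \<phi>" and \<delta>: "0 < \<delta>"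
    and close: "\<And>P e e'. approx_iso M N \<delta> P \<Longrightarrow> \<forall>j\<in>free_vars \<phi>. (e j, e' j) \<in> P \<Longrightarrow>
      range e \<subseteq> pts M \<Longrightarrow> range e' \<subseteq> pts N \<Longrightarrow> \<bar>val M \<phi> e - val N \<phi> e'\<bar> \<le> \<epsilon>"
    and P: "approx_iso M N (min (\<delta> / 23) (1/8)) P"
    and fv: "\<forall>j\<in>free_vars \<phi> - {i}. (e j, e' j) \<in> P"
    and e: "range e \<subseteq> pts M" "range e' \<subseteq> pts N"
  shows "\<bar>val M (FSup i \<phi>) e - val N (FSup i \<phi>) e'\<bar> \<le> \<epsilon>"
    "\<bar>val M (FInf i \<phi>) e - val N (FInf i \<phi>) e'\<bar> \<le> \<epsilon>"
proof -
  define \<eta> where "\<eta> = min (\<delta> / 23) (1/8)"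
  have \<eta>: "0 < \<eta>" "\<eta> \<le> 1/8" "23 * \<eta> \<le> \<delta>" using \<delta> by (auto simp: \<eta>_def min_def)
  have P': "approx_iso M N \<eta> P" using P by (simp add: \<eta>_def)
  have close': "\<bar>val M \<phi> (e(i := a)) - val N \<phi> (e'(i := b))\<bar> \<le> \<epsilon>"
    if "approx_iso M N (23 * \<eta>) (insert (a, b) P)" for a b
  proof (rule close[OF approx_iso_mono[OF that \<eta>(3)]])
    have "a \<in> pts M" "b \<in> pts N" using that by (auto simp: approx_iso_def)
    then show "range (e(i := a)) \<subseteq> pts M" "range (e'(i := b)) \<subseteq> pts N" using e by auto
    show "\<forall>j\<in>free_vars \<phi>. ((e(i := a)) j, (e'(i := b)) j) \<in> insert (a, b) P" using fv by auto
  qed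
  have 1: "\<exists>b\<in>pts N. \<bar>val M \<phi> (e(i := a)) - val N \<phi> (e'(i := b))\<bar> \<le> \<epsilon>" if "a \<in> pts M" for a
    using approx_iso_extend[OF M N P' \<eta>(1,2) that] close' by blast
  have 2: "\<exists>a\<in>pts M. \<bar>val M \<phi> (e(i := a)) - val N \<phi> (e'(i := b))\<bar> \<le> \<epsilon>" if b: "b \<in> pts N" for b
  proof -
    obtain a where a: "a \<in> pts M" "approx_iso N M (23 * \<eta>) (insert (b, a) (P\<inverse>))"
      using approx_iso_extend[OF N M approx_iso_converse[OF P'] \<eta>(1,2) b] by blast
    moreover have "(insert (b, a) (P\<inverse>))\<inverse> = insert (a, b) P" by auto
    ultimately have "approx_iso M N (23 * \<eta>) (insert (a, b) P)" using approx_iso_converse by metis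
    then show ?thesis using close' a(1) by blast
  qed
  have 3: "val M \<phi> (e(i := a)) \<in> {0..1}" if "a \<in> pts M" for a
    by (rule val_in_unit[OF M wf]) (use that e in auto)
  have 4: "val N \<phi> (e'(i := b)) \<in> {0..1}" if "b \<in> pts N" for b
    by (rule val_in_unit[OF N wf]) (use that e in auto)
  note * = SUP_INF_diff_le[OF UDCO_model_nonempty[OF M] UDCO_model_nonempty[OF N],
    where f = "\<lambda>a. val M \<phi> (e(i := a))" and g = "\<lambda>b. val N \<phi> (e'(i := b))" and \<epsilon> = \<epsilon>, OF 3 4 1 2]
  show "\<bar>val M (FSup i \<phi>) e - val N (FSup i \<phi>) e'\<bar> \<le> \<epsilon>"
    "\<bar>val M (FInf i \<phi>) e - val N (FInf i \<phi>) e'\<bar> \<le> \<epsilon>"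
    using * by simp_all
qed

text \<open>For the given models the tolerance depends only on the formula and
  \<open>\<epsilon>\<close>, not on the size of the partial map; this uniformity lets the induction
  pass through quantifiers, each of which adds a pair.\<close>

lemma approx_iso_val_close:
  fixes M :: "'a cyc_structure" and N :: "'b cyc_structure"
  assumes M: "UDCO_model M" and N: "UDCO_model N"
  shows "wf_fm \<phi> \<Longrightarrow> 0 < \<epsilon> \<Longrightarrow> \<exists>\<delta>>0. \<forall>P e e'. approx_iso M N \<delta> P \<longrightarrow>
     (\<forall>i\<in>free_vars \<phi>. (e i, e' i) \<in> P) \<longrightarrow> range e \<subseteq> pts M \<longrightarrow> range e' \<subseteq> pts N \<longrightarrow>
     \<bar>val M \<phi> e - val N \<phi> e'\<bar> \<le> \<epsilon>"
proof (induction \<phi> arbitrary: \<epsilon>)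
  case (FDist i j)
  then show ?case by (intro exI[of _ \<epsilon>]) (simp add: approx_iso_dst)
next
  case (FCyc i j k)
  then show ?case by (intro exI[of _ \<epsilon>]) (simp add: approx_iso_dcyc)
next
  case (FConn u \<phi>s)
  obtain \<eta> where \<eta>: "0 < \<eta>" "\<And>x y. x \<in> cube (length \<phi>s) \<Longrightarrow> y \<in> cube (length \<phi>s) \<Longrightarrow>
      (\<And>i. i < length \<phi>s \<Longrightarrow> \<bar>x i - y i\<bar> \<le> \<eta>) \<Longrightarrow> \<bar>u x - u y\<bar> \<le> \<epsilon>"
    using connective_uniformly_continuous[of "length \<phi>s" u \<epsilon>] FConn.prems by auto
  define ok where "ok = (\<lambda>\<delta> \<phi>. \<forall>P e e'. approx_iso M N \<delta> P \<longrightarrow>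
     (\<forall>i\<in>free_vars \<phi>. (e i, e' i) \<in> P) \<longrightarrow> range e \<subseteq> pts M \<longrightarrow> range e' \<subseteq> pts N \<longrightarrow>
     \<bar>val M \<phi> e - val N \<phi> e'\<bar> \<le> \<eta>)"
  have "\<exists>\<delta>>0. ok \<delta> \<phi>" if "\<phi> \<in> set \<phi>s" for \<phi>
    unfolding ok_def using FConn.IH[OF that _ \<eta>(1)] FConn.prems(1) that by simp
  then obtain D where D: "\<And>\<phi>. \<phi> \<in> set \<phi>s \<Longrightarrow> 0 < D \<phi>" "\<And>\<phi>. \<phi> \<in> set \<phi>s \<Longrightarrow> ok (D \<phi>) \<phi>" by metis
  \<comment> \<open>The inserted 1 serves connectives without arguments, for which the image is
    empty.\<close>
  define \<delta> where "\<delta> = Min (insert 1 (D ` set \<phi>s))"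
  have \<delta>: "0 < \<delta>" "\<And>\<phi>. \<phi> \<in> set \<phi>s \<Longrightarrow> \<delta> \<le> D \<phi>" using D by (auto simp: \<delta>_def)
  show ?case
  proof (intro exI[of _ \<delta>] conjI allI impI)
    show "0 < \<delta>" by fact
    fix P e e'
    assume P: "approx_iso M N \<delta> P" and fv: "\<forall>i\<in>free_vars (FConn u \<phi>s). (e i, e' i) \<in> P"
      and r: "range e \<subseteq> pts M" "range e' \<subseteq> pts N"
    have "\<bar>val M \<phi> e - val N \<phi> e'\<bar> \<le> \<eta>" if "\<phi> \<in> set \<phi>s" for \<phi>
      using D(2)[OF that] approx_iso_mono[OF P \<delta>(2)[OF that]] fv r that unfolding ok_def by auto
    then show "\<bar>val M (FConn u \<phi>s) e - val N (FConn u \<phi>s) e'\<bar> \<le> \<epsilon>"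
      using val_in_unit[OF M _ r(1)] val_in_unit[OF N _ r(2)] FConn.prems(1)
      by (auto intro!: \<eta>(2) simp: cube_def)
  qed
next
  case (FSup i \<phi>)
  then have wf: "wf_fm \<phi>" by simp
  obtain \<delta> where \<delta>: "0 < \<delta>" and close: "\<forall>P e e'. approx_iso M N \<delta> P \<longrightarrow>
     (\<forall>i\<in>free_vars \<phi>. (e i, e' i) \<in> P) \<longrightarrow> range e \<subseteq> pts M \<longrightarrow> range e' \<subseteq> pts N \<longrightarrow>
     \<bar>val M \<phi> e - val N \<phi> e'\<bar> \<le> \<epsilon>"
    using FSup.IH[OF wf FSup.prems(2)] by (elim exE conjE)
  show ?case
    using approx_iso_quantifier(1)[OF M N wf \<delta> close[rule_format]] \<delta>
    by (intro exI[of _ "min (\<delta> / 23) (1/8)"]) simp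
next
  case (FInf i \<phi>)
  then have wf: "wf_fm \<phi>" by simp
  obtain \<delta> where \<delta>: "0 < \<delta>" and close: "\<forall>P e e'. approx_iso M N \<delta> P \<longrightarrow>
     (\<forall>i\<in>free_vars \<phi>. (e i, e' i) \<in> P) \<longrightarrow> range e \<subseteq> pts M \<longrightarrow> range e' \<subseteq> pts N \<longrightarrow>
     \<bar>val M \<phi> e - val N \<phi> e'\<bar> \<le> \<epsilon>"
    using FInf.IH[OF wf FInf.prems(2)] by (elim exE conjE)
  show ?case
    using approx_iso_quantifier(2)[OF M N wf \<delta> close[rule_format]] \<delta>
    by (intro exI[of _ "min (\<delta> / 23) (1/8)"]) simp
qed

theorem UDCO_models_elem_equiv:
  fixes M :: "'a cyc_structure" and N :: "'b cyc_structure"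
  assumes M: "UDCO_model M" and N: "UDCO_model N"
  shows "elem_equiv M N"
  unfolding elem_equiv_def
proof (intro allI impI)
  fix \<phi> and e :: "nat \<Rightarrow> 'a" and e' :: "nat \<Rightarrow> 'b"
  assume \<phi>: "sentence \<phi>" and e: "range e \<subseteq> pts M" "range e' \<subseteq> pts N"
  have "\<bar>val M \<phi> e - val N \<phi> e'\<bar> \<le> \<epsilon>" if \<epsilon>: "0 < \<epsilon>" for \<epsilon>
  proof -
    obtain \<delta> where \<delta>: "0 < \<delta>" and close: "\<forall>P e e'. approx_iso M N \<delta> P \<longrightarrow>
     (\<forall>i\<in>free_vars \<phi>. (e i, e' i) \<in> P) \<longrightarrow> range e \<subseteq> pts M \<longrightarrow> range e' \<subseteq> pts N \<longrightarrow>
     \<bar>val M \<phi> e - val N \<phi> e'\<bar> \<le> \<epsilon>"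
      using approx_iso_val_close[OF M N _ \<epsilon>, of \<phi>] \<phi> unfolding sentence_def by blast
    obtain R where R: "dense_ultra_cyclic (pts M) (dst M) R"
      and dM: "\<And>x y z. x \<in> pts M \<Longrightarrow> y \<in> pts M \<Longrightarrow> z \<in> pts M \<Longrightarrow> dcyc M x y z = ultra_cyclic.dc (dst M) R x y z"
      using UDCO_model_dense_ultra_cyclic[OF M] by metis
    obtain S where S: "dense_ultra_cyclic (pts N) (dst N) S"
      and dN: "\<And>x y z. x \<in> pts N \<Longrightarrow> y \<in> pts N \<Longrightarrow> z \<in> pts N \<Longrightarrow> dcyc N x y z = ultra_cyclic.dc (dst N) S x y z"
      using UDCO_model_dense_ultra_cyclic[OF N] by metis
    interpret R: dense_ultra_cyclic "pts M" "dst M" R by fact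
    interpret S: dense_ultra_cyclic "pts N" "dst N" S by fact
    obtain x y where x: "x \<in> pts M" "y \<in> pts M" "1 - \<delta> < dst M x y" using R.ex_far[OF \<delta>] by blast
    obtain x' y' where y: "x' \<in> pts N" "y' \<in> pts N" "1 - \<delta> < dst N x' y'" using S.ex_far[OF \<delta>] by blast
    have d0: "dst M x x = 0" "dst M y y = 0" "dst N x' x' = 0" "dst N y' y' = 0"
      using x y R.zero S.zero by blast+
    have d: "\<bar>dst M x y - dst N x' y'\<bar> \<le> \<delta>"
      using R.le_one[OF x(1,2)] S.le_one[OF y(1,2)] x(3) y(3) by linarith
    \<comment> \<open>A far pair in each model starts the back-and-forth. A triple taken from two
      points has a repeated entry, so all cyclic distances vanish.\<close>
    have "approx_iso M N \<delta> {(x, x'), (y, y')}"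
      unfolding approx_iso_def using x y d d0 \<delta> R.commute[of y x] S.commute[of y' x']
      by (auto simp: dM dN R.dc_def S.dc_def nonstrict_def)
    moreover have "\<forall>i\<in>free_vars \<phi>. (e i, e' i) \<in> {(x, x'), (y, y')}"
      using \<phi> by (simp add: sentence_def)
    ultimately show ?thesis using close e by blast
  qed
  then have "\<bar>val M \<phi> e - val N \<phi> e'\<bar> \<le> 0 + \<epsilon>" if "0 < \<epsilon>" for \<epsilon> using that by simp
  then have "\<bar>val M \<phi> e - val N \<phi> e'\<bar> \<le> 0" by (rule field_le_epsilon)
  then show "val M \<phi> e = val N \<phi> e'" by simp
qed


section \<open>A model\<close>

text \<open>Finiteness of the support above every positive level makes the supremum in \<open>lex_dist\<close> a
  maximum and survives limits of Cauchy sequences. Integer entries can be moved up and down, which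
  gives every point neighbours on both sides at all rational distances.\<close>

definition lex_seqs :: "(rat \<Rightarrow> int) set" where
  "lex_seqs = {f. (\<forall>q. f q \<noteq> 0 \<longrightarrow> 0 < q \<and> q < 1) \<and> (\<forall>r>0. finite {q. r \<le> q \<and> f q \<noteq> 0})}"

definition lex_dist :: "(rat \<Rightarrow> int) \<Rightarrow> (rat \<Rightarrow> int) \<Rightarrow> real" where
  "lex_dist f g = Sup (insert 0 (of_rat ` {q. 0 < q \<and> q < 1 \<and> f q \<noteq> g q}))"

text \<open>The order is decided at the largest index of difference, the same index that
  \<open>lex_dist\<close> measures; this agreement is what makes balls convex.\<close>

definition lex_less :: "(rat \<Rightarrow> int) \<Rightarrow> (rat \<Rightarrow> int) \<Rightarrow> bool" where
  "lex_less f g \<longleftrightarrow> (\<exists>q. f q < g q \<and> (\<forall>r>q. f r = g r))"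

text \<open>The linear order is closed up to a circle: the oriented triples are the rotations of
  increasing ones.\<close>

definition cyc_of_less :: "('a \<Rightarrow> 'a \<Rightarrow> bool) \<Rightarrow> 'a \<Rightarrow> 'a \<Rightarrow> 'a \<Rightarrow> bool" where
  "cyc_of_less L x y z \<longleftrightarrow> L x y \<and> L y z \<or> L y z \<and> L z x \<or> L z x \<and> L x y"

section \<open>The lexicographic ultrametric\<close>

lemma lex_dist_commute: "lex_dist f g = lex_dist g f"
proof -
  have "{q. 0 < q \<and> q < 1 \<and> f q \<noteq> g q} = {q. 0 < q \<and> q < 1 \<and> g q \<noteq> f q}" by auto
  then show ?thesis by (simp only: lex_dist_def)
qed

lemma of_rat_le_one: "q < 1 \<Longrightarrow> real_of_rat q \<le> 1"
  using of_rat_less_eq[of q 1, where 'a = real] by simp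

lemma lex_dist_bdd: "bdd_above (insert 0 (real_of_rat ` {q. 0 < q \<and> q < 1 \<and> f q \<noteq> g q}))"
  by (rule bdd_aboveI[of _ 1]) (auto intro: of_rat_le_one)

lemma lex_dist_nonneg: "0 \<le> lex_dist f g"
  unfolding lex_dist_def by (rule cSup_upper[OF _ lex_dist_bdd]) simp

lemma lex_dist_le_one: "lex_dist f g \<le> 1"
  unfolding lex_dist_def by (rule cSup_least) (auto intro: of_rat_le_one)

lemma lex_dist_same: "lex_dist f f = 0"
  by (simp add: lex_dist_def)

text \<open>Both functions have finitely many nonzero entries from any positive index on, so the
  differences from some \<open>p\<close> on form a finite set, whose maximum is the index
  sought.\<close>

lemma lex_seqs_top_difference:
  assumes f: "f \<in> lex_seqs" and g: "g \<in> lex_seqs" and ne: "f \<noteq> g"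
  obtains q where "0 < q" "q < 1" "f q \<noteq> g q" "\<And>r. q < r \<Longrightarrow> f r = g r" "lex_dist f g = of_rat q"
proof -
  obtain p where p: "f p \<noteq> g p" using ne by auto
  have in01: "0 < q \<and> q < 1" if "f q \<noteq> g q" for q
    using f g that unfolding lex_seqs_def by (cases "f q = 0") auto
  let ?S = "{q. p \<le> q \<and> f q \<noteq> g q}"
  have "?S \<subseteq> {q. p \<le> q \<and> f q \<noteq> 0} \<union> {q. p \<le> q \<and> g q \<noteq> 0}" by auto
  then have fin: "finite ?S" using f g in01[OF p] unfolding lex_seqs_def
    by (auto intro: finite_subset)
  define q where "q = Max ?S"
  have q: "q \<in> ?S" unfolding q_def using p by (intro Max_in fin) auto
  have top: "f r = g r" if "q < r" for r
  proof (rule ccontr)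
    assume "f r \<noteq> g r"
    then have "r \<in> ?S" using that q by auto
    then show False using Max_ge[OF fin] that by (fastforce simp: q_def)
  qed
  have "lex_dist f g = of_rat q" unfolding lex_dist_def
  proof (rule cSup_eq_maximum)
    show "real_of_rat q \<in> insert 0 (real_of_rat ` {q. 0 < q \<and> q < 1 \<and> f q \<noteq> g q})" using q in01 by auto
    show "x \<le> real_of_rat q" if "x \<in> insert 0 (real_of_rat ` {q. 0 < q \<and> q < 1 \<and> f q \<noteq> g q})" for x
    proof -
      have "r \<le> q" if "f r \<noteq> g r" for r using top[of r] that by (meson not_le)
      moreover have "0 \<le> q" using in01 q by force
      ultimately show ?thesis using that by (auto simp: of_rat_less_eq)
    qed
  qed
  then show thesis using that[of q] q in01 top by auto
qed

text \<open>Balls become conditions of agreement from an index on; the ultrametric inequality,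
  completeness and the convexity of balls are all read off from this form.\<close>

lemma lex_dist_less_iff:
  assumes "f \<in> lex_seqs" "g \<in> lex_seqs" "0 < r"
  shows "lex_dist f g < r \<longleftrightarrow> (\<forall>q. r \<le> of_rat q \<longrightarrow> f q = g q)"
proof (cases "f = g")
  case False
  obtain q where q: "f q \<noteq> g q" "\<And>r. q < r \<Longrightarrow> f r = g r" "lex_dist f g = of_rat q"
    using lex_seqs_top_difference[OF assms(1,2) False] by metis
  show ?thesis
  proof
    assume "lex_dist f g < r"
    then have "q < p" if "r \<le> of_rat p" for p
      using that q(3) of_rat_less[of q p, where 'a = real] by linarith
    then show "\<forall>p. r \<le> of_rat p \<longrightarrow> f p = g p" using q(2) by blast
  next
    assume "\<forall>p. r \<le> of_rat p \<longrightarrow> f p = g p"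
    then show "lex_dist f g < r" using q(1,3) not_le by metis
  qed
qed (use assms in \<open>simp add: lex_dist_same\<close>)

lemma lex_dist_zero_iff:
  assumes "f \<in> lex_seqs" "g \<in> lex_seqs"
  shows "lex_dist f g = 0 \<longleftrightarrow> f = g"
proof
  assume 0: "lex_dist f g = 0"
  show "f = g"
  proof (rule ccontr)
    assume "f \<noteq> g"
    then obtain q where "0 < q" "lex_dist f g = of_rat q" using lex_seqs_top_difference[OF assms] by metis
    then show False using 0 by simp
  qed
qed (simp add: lex_dist_same)

lemma lex_dist_ultra:
  assumes "f \<in> lex_seqs" "g \<in> lex_seqs" "h \<in> lex_seqs"
  shows "lex_dist f h \<le> max (lex_dist f g) (lex_dist g h)"
proof (rule dense_ge)
  fix r assume r: "max (lex_dist f g) (lex_dist g h) < r"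
  then have "0 < r" using lex_dist_nonneg[of f g] by linarith
  then have "lex_dist f h < r" using r assms by (simp add: lex_dist_less_iff)
  then show "lex_dist f h \<le> r" by simp
qed

section \<open>The lexicographic order, its intervals, and limits\<close>

lemma lex_less_trans: "lex_less f g \<Longrightarrow> lex_less g h \<Longrightarrow> lex_less f h"
proof -
  assume "lex_less f g" "lex_less g h"
  then obtain p q where p: "f p < g p" "\<And>r. p < r \<Longrightarrow> f r = g r" and q: "g q < h q" "\<And>r. q < r \<Longrightarrow> g r = h r"
    unfolding lex_less_def by blast
  have "f (max p q) < h (max p q)" using p q by (cases p q rule: linorder_cases) (auto simp: max_def)
  moreover have "f r = h r" if "max p q < r" for r using that p(2) q(2) by simp
  ultimately show ?thesis unfolding lex_less_def by blast
qed

lemma lex_less_irrefl: "\<not> lex_less f f"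
  by (simp add: lex_less_def)

lemma lex_less_total:
  assumes "f \<in> lex_seqs" "g \<in> lex_seqs" "f \<noteq> g"
  shows "lex_less f g \<or> lex_less g f"
proof -
  obtain q where "f q \<noteq> g q" "\<And>r. q < r \<Longrightarrow> f r = g r"
    using lex_seqs_top_difference[OF assms] by metis
  then show ?thesis unfolding lex_less_def by (metis linorder_neqE)
qed

text \<open>At the larger of the two indices that decide \<open>lex_less f g\<close> and
  \<open>lex_less g h\<close>, the function \<open>f\<close> is strictly below \<open>h\<close>, so
  this index lies below \<open>r\<close>.\<close>

lemma lex_between:
  assumes "lex_less f g" "lex_less g h" "\<And>q. r \<le> q \<Longrightarrow> f q = h q" "r \<le> q"
  shows "f q = g q"
proof -
  obtain p p' where p: "f p < g p" "\<And>r. p < r \<Longrightarrow> f r = g r" and p': "g p' < h p'" "\<And>r. p' < r \<Longrightarrow> g r = h r"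
    using assms(1,2) unfolding lex_less_def by blast
  have "p < r"
  proof (rule ccontr)
    assume "\<not> p < r"
    then show False using p p' assms(3)[of p] assms(3)[of p'] by (cases p p' rule: linorder_cases) auto
  qed
  then show ?thesis using p(2) assms(4) by simp
qed

text \<open>The integers have neither a least nor a greatest element, so an entry can be changed in
  either direction whatever its value is.\<close>

lemma lex_shift:
  assumes f: "f \<in> lex_seqs" and q: "0 < q" "q < 1" and k: "k \<noteq> 0"
  defines "g \<equiv> f(q := f q + k)"
  shows "g \<in> lex_seqs" "lex_dist f g = of_rat q" "0 < k \<Longrightarrow> lex_less f g" "k < 0 \<Longrightarrow> lex_less g f"
proof -
  have sub: "{p. r \<le> p \<and> g p \<noteq> 0} \<subseteq> insert q {p. r \<le> p \<and> f p \<noteq> 0}" for r by (auto simp: g_def)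
  show g: "g \<in> lex_seqs" using f q finite_subset[OF sub] unfolding lex_seqs_def
    by (auto simp: g_def split: if_splits)
  have "f \<noteq> g" using k by (auto simp: g_def fun_eq_iff)
  then obtain p where "f p \<noteq> g p" "lex_dist f g = of_rat p" using lex_seqs_top_difference[OF f g] by metis
  then show "lex_dist f g = of_rat q" by (auto simp: g_def split: if_splits)
  show "0 < k \<Longrightarrow> lex_less f g" "k < 0 \<Longrightarrow> lex_less g f" unfolding lex_less_def
    by (auto simp: g_def intro!: exI[of _ q])
qed

text \<open>From any positive index on, all entries become constant at a common stage. The limit
  therefore agrees there with a member of the sequence and inherits the finiteness of its
  support.\<close>

lemma lex_Cauchy_limit:
  fixes \<sigma> :: "nat \<Rightarrow> rat \<Rightarrow> int"
  assumes \<sigma>: "\<And>n. \<sigma> n \<in> lex_seqs"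
    and Cauchy: "\<And>\<epsilon>. 0 < \<epsilon> \<Longrightarrow> \<exists>N. \<forall>n n'. N \<le> n \<longrightarrow> N \<le> n' \<longrightarrow> lex_dist (\<sigma> n) (\<sigma> n') < \<epsilon>"
  obtains f where "f \<in> lex_seqs" "\<And>\<epsilon>. 0 < \<epsilon> \<Longrightarrow> \<exists>N. \<forall>n\<ge>N. lex_dist (\<sigma> n) f < \<epsilon>"
proof -
  have "\<exists>N. \<forall>n n' q. N \<le> n \<longrightarrow> N \<le> n' \<longrightarrow> r \<le> q \<longrightarrow> \<sigma> n q = \<sigma> n' q" if "0 < r" for r :: rat
    using Cauchy[of "of_rat r"] that \<sigma> by (simp add: lex_dist_less_iff of_rat_less_eq)
  then obtain K where K: "\<And>r n n' q. 0 < r \<Longrightarrow> K r \<le> n \<Longrightarrow> K r \<le> n' \<Longrightarrow> r \<le> q \<Longrightarrow> \<sigma> n q = \<sigma> n' q"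
    by metis
  \<comment> \<open>Each entry is read at its own stage \<open>K q\<close>; the \<open>max\<close>
    in the proof of \<open>eq\<close> compares this stage with the common stage
    \<open>K r\<close>.\<close>
  define f where "f q = (if 0 < q then \<sigma> (K q) q else 0)" for q
  have eq: "f q = \<sigma> n q" if "0 < r" "r \<le> q" "K r \<le> n" for r q n
  proof -
    have q: "0 < q" using that by simp
    have "\<sigma> (K q) q = \<sigma> (max (K q) (K r)) q" using K[OF q, of "K q" "max (K q) (K r)" q] by simp
    also have "\<dots> = \<sigma> n q" using K[OF that(1), of "max (K q) (K r)" n q] that by simp
    finally show ?thesis using q by (simp add: f_def)
  qed
  have f: "f \<in> lex_seqs" unfolding lex_seqs_def
  proof (intro CollectI conjI allI impI)
    fix q assume "f q \<noteq> 0"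
    then show "0 < q" "q < 1" using \<sigma>[of "K q"] by (auto simp: f_def lex_seqs_def split: if_splits)
  next
    fix r :: rat assume r: "0 < r"
    have "{q. r \<le> q \<and> f q \<noteq> 0} = {q. r \<le> q \<and> \<sigma> (K r) q \<noteq> 0}" using eq[OF r _ order_refl] by auto
    then show "finite {q. r \<le> q \<and> f q \<noteq> 0}" using \<sigma>[of "K r"] r by (simp add: lex_seqs_def)
  qed
  have "\<exists>N. \<forall>n\<ge>N. lex_dist (\<sigma> n) f < \<epsilon>" if \<epsilon>: "0 < \<epsilon>" for \<epsilon>
  proof -
    obtain r where r: "0 < r" "real_of_rat r < \<epsilon>" using of_rat_dense[of 0 \<epsilon>] \<epsilon> by auto
    have "lex_dist (\<sigma> n) f < \<epsilon>" if n: "K r \<le> n" for n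
      unfolding lex_dist_less_iff[OF \<sigma> f \<epsilon>]
    proof (intro allI impI)
      fix q assume "\<epsilon> \<le> real_of_rat q"
      then have "r \<le> q" using r(2) of_rat_less_eq[of r q, where 'a = real] by linarith
      then show "\<sigma> n q = f q" using eq[OF r(1) _ n] by simp
    qed
    then show ?thesis by blast
  qed
  then show thesis using that f by blast
qed

section \<open>From the linear order to a model on the reals\<close>

lemma cyc_of_less_strict_cyclic_order:
  assumes irrefl: "\<And>x. \<not> L x x"
    and trans: "\<And>x y z. x \<in> X \<Longrightarrow> y \<in> X \<Longrightarrow> z \<in> X \<Longrightarrow> L x y \<Longrightarrow> L y z \<Longrightarrow> L x z"
    and total: "\<And>x y. x \<in> X \<Longrightarrow> y \<in> X \<Longrightarrow> x \<noteq> y \<Longrightarrow> L x y \<or> L y x"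
  shows "strict_cyclic_order X (cyc_of_less L)"
  unfolding strict_cyclic_order_def
proof (intro conjI ballI impI)
  fix a b c assume X: "a \<in> X" "b \<in> X" "c \<in> X"
  show "cyc_of_less L b c a" if "cyc_of_less L a b c"
    using that unfolding cyc_of_less_def by blast
  show "\<not> cyc_of_less L c b a" if "cyc_of_less L a b c"
    using that X irrefl trans unfolding cyc_of_less_def by metis
  show "cyc_of_less L a b c \<or> cyc_of_less L c b a" if "a \<noteq> b" "b \<noteq> c" "c \<noteq> a"
    using that total[OF X(1,2)] total[OF X(2,3)] total[OF X(3,1)] unfolding cyc_of_less_def by blast
  show "cyc_of_less L a b d" if "d \<in> X" "cyc_of_less L a b c" "cyc_of_less L a c d" for d
    using that X irrefl trans unfolding cyc_of_less_def by metis
qed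

text \<open>The construction is carried along a bijection so that the model can live on a type
  chosen in advance.\<close>

lemma lex_UDCO_model:
  fixes X :: "'a set" and g :: "'a \<Rightarrow> rat \<Rightarrow> int"
  assumes g: "bij_betw g X lex_seqs"
  shows "\<exists>M :: 'a cyc_structure. UDCO_model M"
proof -
  define d where "d x y = lex_dist (g x) (g y)" for x y
  define L where "L x y \<longleftrightarrow> lex_less (g x) (g y)" for x y
  define R where "R = cyc_of_less L"
  define M where "M = \<lparr>pts = X, dst = d, dcyc = (\<lambda>x y z. INF (x', y', z')\<in>nonstrict_set X R.
      max (d x x') (max (d y y') (d z z')))\<rparr>"
  have M [simp]: "pts M = X" "dst M = d" by (simp_all add: M_def)
  have gX: "g x \<in> lex_seqs" if "x \<in> X" for x using that g by (auto simp: bij_betw_def)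
  have ginj: "g x = g y \<longleftrightarrow> x = y" if "x \<in> X" "y \<in> X" for x y
    using that g by (auto simp: bij_betw_def inj_on_def)
  have gsurj: "\<exists>x\<in>X. g x = f" if "f \<in> lex_seqs" for f
  proof -
    have "f \<in> g ` X" using that g by (simp add: bij_betw_def)
    then show ?thesis by blast
  qed
  have Lirr: "\<not> L x x" for x by (simp add: L_def lex_less_irrefl)
  have Ltrans: "L x y \<Longrightarrow> L y z \<Longrightarrow> L x z" for x y z unfolding L_def by (rule lex_less_trans)
  have Ltotal: "L x y \<or> L y x" if "x \<in> X" "y \<in> X" "x \<noteq> y" for x y
    unfolding L_def using lex_less_total gX ginj that by blast
  have ultra: "d x z \<le> max (d x y) (d y z)" if "x \<in> X" "y \<in> X" "z \<in> X" for x y z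
    using lex_dist_ultra gX that by (simp add: d_def)
  have d0: "d x x = 0" for x by (simp add: d_def lex_dist_same)
  have nonneg: "0 \<le> d x y" for x y by (simp add: d_def lex_dist_nonneg)
  interpret Metric_space X d
  proof
    show "d x y = d y x" for x y unfolding d_def by (rule lex_dist_commute)
    show "d x y = 0 \<longleftrightarrow> x = y" if "x \<in> X" "y \<in> X" for x y
      using lex_dist_zero_iff gX ginj that by (simp add: d_def)
    show "d x z \<le> d x y + d y z" if "x \<in> X" "y \<in> X" "z \<in> X" for x y z
      using ultra[OF that] nonneg[of x y] nonneg[of y z] by linarith
  qed (rule nonneg)
  have zero_seq: "(\<lambda>_. 0) \<in> lex_seqs" by (simp add: lex_seqs_def)
  then have ne: "X \<noteq> {}" using gsurj by blast
  have complete: "mcomplete"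
    unfolding mcomplete_def
  proof (intro allI impI)
    fix \<sigma> assume \<sigma>: "MCauchy \<sigma>"
    have X: "\<sigma> n \<in> X" for n using \<sigma> by (auto simp: MCauchy_def)
    obtain f where f: "f \<in> lex_seqs" "\<And>\<epsilon>. 0 < \<epsilon> \<Longrightarrow> \<exists>N. \<forall>n\<ge>N. lex_dist (g (\<sigma> n)) f < \<epsilon>"
      using lex_Cauchy_limit[of "\<lambda>n. g (\<sigma> n)"] gX[OF X] \<sigma> unfolding MCauchy_def d_def by metis
    obtain x where x: "x \<in> X" "g x = f" using gsurj f(1) by blast
    have "limitin mtopology \<sigma> x sequentially"
      unfolding limit_metric_sequentially using x X f(2) by (simp add: d_def)
    then show "\<exists>x. limitin mtopology \<sigma> x sequentially" by blast
  qed
  have between: "d x b < r" if X: "x \<in> X" "a \<in> X" "b \<in> X" "c \<in> X" and L: "L a b" "L b c"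
    and dr: "d x a < r" "d x c < r" for x a b c r
  proof -
    have r: "0 < r" using dr(1) nonneg[of x a] by linarith
    have ac: "\<forall>q. r \<le> of_rat q \<longrightarrow> g x q = g a q" "\<forall>q. r \<le> of_rat q \<longrightarrow> g x q = g c q"
      using dr lex_dist_less_iff[OF _ _ r] gX X by (simp_all add: d_def)
    have "g x q = g b q" if q: "r \<le> of_rat q" for q
    proof -
      have "g a p = g c p" if "q \<le> p" for p
      proof -
        have "r \<le> of_rat p" using q that of_rat_less_eq[of q p, where 'a = real] by linarith
        then show ?thesis using ac by metis
      qed
      then have "g a q = g b q" using lex_between[of "g a" "g b" "g c" q q] L by (simp add: L_def)
      then show ?thesis using ac(1) q by metis
    qed
    then show ?thesis using lex_dist_less_iff[OF _ _ r] gX X by (simp add: d_def)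
  qed
  have convex: "order_convex X R (mball x r)" if x: "x \<in> X" for x r
    unfolding order_convex_def
  proof (intro ballI impI)
    fix a b assume a: "a \<in> mball x r" and b: "b \<in> mball x r" and "a \<noteq> b"
    have ab: "a \<in> X" "b \<in> X" "d x a < r" "d x b < r" using a b by auto
    \<comment> \<open>Of the two arcs, the one from the smaller to the larger point is an interval
      of the linear order and therefore stays in the ball.\<close>
    have arc: "\<forall>z\<in>X. nonstrict R u z v \<longrightarrow> z \<in> mball x r"
      if uv: "u \<in> X" "v \<in> X" "d x u < r" "d x v < r" "L u v" for u v
    proof (intro ballI impI)
      fix z assume z: "z \<in> X" "nonstrict R u z v"
      have nv: "\<not> L v u" "v \<noteq> u" using uv(5) Ltrans Lirr by blast+
      then have "z = u \<or> z = v \<or> L u z \<and> L z v"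
        using z(2) unfolding nonstrict_def R_def cyc_of_less_def by blast
      then have "d x z < r" using between[OF x uv(1) z(1) uv(2)] uv(3,4) by blast
      then show "z \<in> mball x r" using x z(1) by simp
    qed
    show "(\<forall>c\<in>X. nonstrict R a c b \<longrightarrow> c \<in> mball x r) \<or> (\<forall>c\<in>X. nonstrict R b c a \<longrightarrow> c \<in> mball x r)"
      using Ltotal[OF ab(1,2) \<open>a \<noteq> b\<close>] arc ab by blast
  qed
  have mco: "metric_cyclic_order M R"
    unfolding metric_cyclic_order_def M
  proof (intro conjI ballI allI)
    show "strict_cyclic_order X R" unfolding R_def
      by (rule cyc_of_less_strict_cyclic_order) (use Lirr Ltrans Ltotal in blast)+
    show "d x y \<le> 1" for x y by (simp add: d_def lex_dist_le_one)
    show "dcyc M x y z = (INF (x', y', z')\<in>nonstrict_set X R. max (d x x') (max (d y y') (d z z')))" for x y z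
      by (simp add: M_def)
  qed (fact ne complete convex Metric_space_axioms)+
  have shift: "\<exists>z\<in>X. d x z = of_rat q \<and> (if b then L x z else L z x)"
    if x: "x \<in> X" and q: "0 < q" "q < 1" for x q b
  proof -
    let ?k = "if b then 1 else -1 :: int"
    let ?f = "(g x)(q := g x q + ?k)"
    have k: "?k \<noteq> 0" by simp
    note f = lex_shift[OF gX[OF x] q k]
    obtain z where "z \<in> X" "g z = ?f" using gsurj[OF f(1)] by blast
    then show ?thesis using f by (intro bexI[of _ z]) (auto simp: d_def L_def)
  qed
  have du: "DU_model M"
    unfolding DU_model_def M
  proof (intro conjI ballI subsetI)
    fix a t assume a: "a \<in> X" and t: "t \<in> {0..1::real}"
    show "t \<in> closure (d a ` X)"
      unfolding closure_approachable
    proof (intro allI impI)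
      fix \<epsilon> :: real assume \<epsilon>: "0 < \<epsilon>"
      have "max 0 (t - \<epsilon>) < min 1 (t + \<epsilon>)" using t \<epsilon> by auto
      then obtain q where q: "max 0 (t - \<epsilon>) < real_of_rat q" "real_of_rat q < min 1 (t + \<epsilon>)"
        using of_rat_dense by blast
      then have "0 < q" "q < 1" by auto
      then obtain z where "z \<in> X" "d a z = of_rat q" using shift[OF a, of q True] by blast
      moreover have "dist (real_of_rat q) t < \<epsilon>" using q by (auto simp: dist_real_def)
      ultimately have "dist (d a z) t < \<epsilon>" by simp
      then show "\<exists>y\<in>d a ` X. dist y t < \<epsilon>" using \<open>z \<in> X\<close> by blast
    qed
  qed (fact ultra)
  \<comment> \<open>In this model the infima in the density axioms are attained. With
    \<open>s\<close> the top index of difference of \<open>u\<close> and \<open>v\<close>, the entry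
    of \<open>u\<close> at \<open>p' * s\<close> is shifted up or down; this product is an index
    because all indices are rational.\<close>
  have neighbour: "\<exists>z\<in>X. nonstrict R (if b then v else u) (if b then u else v) z \<and> d u z = p * d u v"
    if uv: "u \<in> X" "v \<in> X" and p: "p \<in> \<rat> \<inter> {0<..<1}" for u v p b
  proof (cases "u = v")
    case True
    then show ?thesis using uv d0 by (intro bexI[of _ u]) (auto simp: nonstrict_def)
  next
    case False
    then obtain s where s: "0 < s" "s < 1" "g u s \<noteq> g v s" "\<And>r. s < r \<Longrightarrow> g u r = g v r" "d u v = of_rat s"
      using lex_seqs_top_difference[OF gX gX, OF uv] ginj[OF uv] unfolding d_def by metis
    obtain p' where p': "p = of_rat p'" using p by (auto elim: Rats_cases)
    have "0 < p'" "p' < 1" using p p' by auto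
    then have ps: "0 < p' * s" "p' * s < 1" "p' * s < s"
      using s(1,2) mult_strict_mono[of p' 1 s 1] by auto
    obtain z where z: "z \<in> X" "d u z = of_rat (p' * s)" "if b then L u z else L z u"
      using shift[OF uv(1) ps(1,2), of b] by blast
    have duz: "d u z = p * d u v" using z(2) s(5) p' by (simp add: of_rat_mult)
    have lt: "d u z < d u v" using z(2) s(5) ps(3) by (simp add: of_rat_less)
    have vne: "v \<noteq> z" "u \<noteq> v" "u \<noteq> z" using lt False z(2) ps(1) d0 by auto
    have "R v u z" if b
    proof -
      have "L u z" using z(3) that by simp
      \<comment> \<open>As \<open>z\<close> is closer to \<open>u\<close> than \<open>v\<close> is,
        convexity of balls forbids \<open>v\<close> to lie between them.\<close>
      moreover have "\<not> (L u v \<and> L v z)"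
      proof
        assume "L u v \<and> L v z"
        then have "d u v < d u v" using between[OF uv(1) uv(1) uv(2) z(1), of "d u v"] lt nonneg[of u z] d0[of u] by auto
        then show False by simp
      qed
      ultimately show ?thesis using Ltotal[OF uv vne(2)] Ltotal[OF uv(2) z(1) vne(1)]
        unfolding R_def cyc_of_less_def by blast
    qed
    moreover have "R u v z" if "\<not> b"
    proof -
      have "L z u" using z(3) that by simp
      moreover have "\<not> (L z v \<and> L v u)"
      proof
        assume "L z v \<and> L v u"
        then have "d u v < d u v" using between[OF uv(1) z(1) uv(2) uv(1), of "d u v"] lt nonneg[of u z] d0[of u] by auto
        then show False by simp
      qed
      ultimately show ?thesis using Ltotal[OF uv vne(2)] Ltotal[OF uv(2) z(1) vne(1)]
        unfolding R_def cyc_of_less_def by blast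
    qed
    ultimately show ?thesis using z(1) duz by (intro bexI[of _ z]) (auto simp: nonstrict_def)
  qed
  have SUP_INF: "(SUP w\<in>X \<times> X. INF w'\<in>nonstrict_set X R. f w w') = 0"
    if nn: "\<And>w w'. 0 \<le> f w w'"
      and ex: "\<And>u v. u \<in> X \<Longrightarrow> v \<in> X \<Longrightarrow> \<exists>w'\<in>nonstrict_set X R. f (u, v) w' = 0"
    for f :: "_ \<Rightarrow> _ \<Rightarrow> real"
  proof -
    have "(INF w'\<in>nonstrict_set X R. f w w') = 0" if w: "w \<in> X \<times> X" for w
    proof -
      obtain w' where w': "w' \<in> nonstrict_set X R" "f w w' = 0" using ex[of "fst w" "snd w"] w by auto
      have "bdd_below (f w ` nonstrict_set X R)" by (rule bdd_belowI[of _ 0]) (elim imageE, hypsubst, rule nn)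
      from cINF_lower[OF this w'(1)] have "(INF w'\<in>nonstrict_set X R. f w w') \<le> 0" using w'(2) by simp
      moreover have "0 \<le> (INF w'\<in>nonstrict_set X R. f w w')"
        by (rule cINF_greatest) (use w' in blast, rule nn)
      ultimately show ?thesis by simp
    qed
    then have "(SUP w\<in>X \<times> X. INF w'\<in>nonstrict_set X R. f w w') = (SUP w\<in>X \<times> X. 0)" by (intro SUP_cong) auto
    also have "\<dots> = 0" using ne by simp
    finally show ?thesis .
  qed
  have "UDCO_axioms M R p" if p: "p \<in> \<rat> \<inter> {0<..<1}" for p
    unfolding UDCO_axioms_def M
  proof
    have "(SUP w\<in>X \<times> X. INF w'\<in>nonstrict_set X R.
        (\<lambda>(u, v) (x, y, z). d u x + d v y + \<bar>d u z - p * d u v\<bar>) w w') = 0"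
    proof (rule SUP_INF)
      fix u v assume uv: "u \<in> X" "v \<in> X"
      obtain z where "z \<in> X" "nonstrict R u v z" "d u z = p * d u v"
        using neighbour[OF uv p, of False] by auto
      then show "\<exists>w'\<in>nonstrict_set X R. (\<lambda>(u, v) (x, y, z). d u x + d v y + \<bar>d u z - p * d u v\<bar>) (u, v) w' = 0"
        using uv d0 by (intro bexI[of _ "(u, v, z)"]) (auto simp: nonstrict_set_def)
    qed (simp add: case_prod_beta nonneg)
    then show "(SUP (u, v)\<in>X \<times> X. INF (x, y, z)\<in>nonstrict_set X R. d u x + d v y + \<bar>d u z - p * d u v\<bar>) = 0"
      by (simp add: case_prod_beta')
    have "(SUP w\<in>X \<times> X. INF w'\<in>nonstrict_set X R.
        (\<lambda>(u, v) (x, y, z). d u x + d v y + \<bar>d v z - p * d u v\<bar>) w w') = 0"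
    proof (rule SUP_INF)
      fix u v assume uv: "u \<in> X" "v \<in> X"
      obtain z where "z \<in> X" "nonstrict R u v z" "d v z = p * d u v"
        using neighbour[OF uv(2,1) p, of True] commute[of u v] by auto
      then show "\<exists>w'\<in>nonstrict_set X R. (\<lambda>(u, v) (x, y, z). d u x + d v y + \<bar>d v z - p * d u v\<bar>) (u, v) w' = 0"
        using uv d0 by (intro bexI[of _ "(u, v, z)"]) (auto simp: nonstrict_set_def)
    qed (simp add: case_prod_beta nonneg)
    then show "(SUP (u, v)\<in>X \<times> X. INF (x, y, z)\<in>nonstrict_set X R. d u x + d v y + \<bar>d v z - p * d u v\<bar>) = 0"
      by (simp add: case_prod_beta')
  qed
  then show ?thesis using mco du unfolding UDCO_model_def by blast
qed

text \<open>A function from the rationals to the integers is coded by its graph, a subset of a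
  countable set, and there are as many subsets of \<open>nat\<close> as real numbers.\<close>

lemma ex_real_UDCO_model: "\<exists>M :: real cyc_structure. UDCO_model M"
proof -
  obtain h :: "nat set \<Rightarrow> real" where h: "inj h"
    using nat_sets_eqpoll_reals by (auto simp: eqpoll_def bij_betw_def)
  define k where "k f = h (to_nat ` {(q, f q) |q. True})" for f :: "rat \<Rightarrow> int"
  have "inj k"
  proof (rule injI)
    fix f f' assume "k f = k f'"
    then have "to_nat ` {(q, f q) |q. True} = to_nat ` {(q, f' q) |q. True}"
      unfolding k_def using h by (simp add: inj_eq)
    then have "{(q, f q) |q. True} = {(q, f' q) |q. True}"
      by (simp add: inj_image_eq_iff)
    then show "f = f'" by (auto simp: set_eq_iff)
  qed
  then have "bij_betw (inv_into lex_seqs k) (k ` lex_seqs) lex_seqs"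
    by (intro bij_betw_inv_into inj_on_imp_bij_betw) (auto intro: inj_on_subset)
  then show ?thesis by (rule lex_UDCO_model)
qed


theorem theorem8p21:
  shows "(\<exists>M :: real cyc_structure. UDCO_model M) \<and>
         (\<forall>(M :: 'a cyc_structure) (N :: 'b cyc_structure).
            UDCO_model M \<longrightarrow> UDCO_model N \<longrightarrow> elem_equiv M N)"
  using ex_real_UDCO_model UDCO_models_elem_equiv by blast

end
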